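(* Let $\mathcal{A}$ be any energy-compatible amoebot algorithm and $\delta:\mathcal{A}\to\{1,2,\ldots,\kappa\}$ any demand function, and let $\mathcal{A}^\delta$ be the algorithm produced from $\mathcal{A}$ and $\delta$ by the energy distribution framework. Let $C_0$ be any (legal) connected initial configuration for $\mathcal{A}$ and let $C_0^\delta$ be its extension for $\mathcal{A}^\delta$ that designates at least one source amoebot and adds the energy distribution variables (state, parent, $e_{bat}$) with their initial values to all amoebots. Then for any configuration $C^\delta$ in which an unfair sequential execution of $\mathcal{A}^\delta$ starting in $C_0^\delta$ terminates, there exists an unfair sequential execution of $\mathcal{A}$ starting in $C_0$ that terminates in a configuration $C$ that is identical to $C^\delta$ modulo the energy distribution variables. Moreover, if all unfair sequential executions of $\mathcal{A}$ on $n$ amoebots terminate after at most $T_{\mathcal{A}}(n)$ action executions, then any unfair sequential execution of $\mathcal{A}^\delta$ on $n$ amoebots terminates in $\mathcal{O}(n^2\,T_{\mathcal{A}}(n))$ rounds.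
   Context: **Amoebot model.** $G_\Delta=(V,E)$ is the infinite triangular lattice. A system consists of finitely many ($n$) amoebots, each occupying one node (contracted) or two adjacent nodes (expanded); each node is occupied by at most one amoebot. Amoebots on adjacent nodes are neighbors; $N(A)$ is the set of neighbors of $A$. Amoebots are anonymous; each has one port per edge from its node(s) to other nodes (6 if contracted, 10 if expanded), labeled according to its own orientation (amoebots may disagree on direction and chirality), and a constant-size public memory. Operations: Connected($p$) (tests for a neighbor at port $p$); Read/Write($p,\cdot$) (access public memory of the neighbor at $p$, or one's own if $p=\bot$); Contract (an expanded amoebot contracts into one of its nodes); Expand (a contracted amoebot expands into an adjacent unoccupied node); Push($p$) (a contracted amoebot expands into a node of the expanded neighbor at $p$, which contracts); Pull($p$) (an expanded amoebot contracts, making the contracted neighbor at $p$ expand into the vacated node); Lock/Unlock (concurrency control). An amoebot algorithm is a finite set of actions $\alpha_i: g_i\to ops_i$, where the guard $g_i$ is a Boolean predicate of which ports of $A$ are connected and of the public memories of $A$ and its neighbors, and $ops_i$ is a finite sequence of operations and private computation. An action is enabled for $A$ if its guard holds; an amoebot is enabled if some action is. A configuration records the node(s) occupied by each amoebot and all public memories; it is legal if it obeys the model and connected if the occupied nodes induce a connected subgraph. In a sequential execution under an unfair adversary, at each step an arbitrary enabled amoebot executes one of its enabled actions while all others are inactive; the execution terminates when no amoebot is enabled. Rounds: $t_0=0$, and round $i$, starting at $t_i$, ends at the earliest time $t_{i+1}>t_i$ by which every amoebot enabled at $t_i$ has completed an action execution or become disabled at some time in $(t_i,t_{i+1}]$.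 **Energy-compatible.** $\mathcal{A}$ (with no associated energy costs) is energy-compatible if every unfair sequential execution of $\mathcal{A}$ terminates and: (Validity) whenever an action is enabled for an amoebot in a legal configuration, its execution succeeds if all other amoebots are inactive; (Phase Structure) each action consists of a compute phase (finite computation and finitely many Connected, Read, Write operations) followed by a move phase (at most one movement operation, decided in the compute phase), with no Lock/Unlock; (Connectivity) every configuration reachable by a sequential execution from a connected configuration is connected. **Energy distribution framework.** The battery capacity $\kappa>0$ is a fixed integer constant independent of $n$. A demand function is a map $\delta:\mathcal{A}\to\{1,\ldots,\kappa\}$. At least one amoebot is designated a source amoebot (access to external energy; a permanent attribute). Each amoebot gets public variables: state $\in\{$source, idle, active, asking, growing, pruning$\}$, initially source for source amoebots and idle otherwise; parent (a port or null), initially null; $e_{bat}\in\{0,\ldots,\kappa\}$, initially $0$. $B$ is a child of $A$ if $B$ is a neighbor of $A$ and $B$.parent points to $A$. Prune() executed by $A$: for every child, set its state to pruning and its parent to null; then set $A$.state to idle if $A$ is not a source amoebot (a source amoebot has state source afterwards). The algorithm $\mathcal{A}^\delta$ consists of the following actions, for executing amoebot $A$. (1) For each $\alpha_i\in\mathcal{A}$, an action $\alpha_i^\delta$ with guard: $g_i$ holds, $A.e_{bat}\ge\delta(\alpha_i)$, and no amoebot in $N(A)\cup\{A\}$ is idle or pruning. Operations: decrease $A.e_{bat}$ by $\delta(\alpha_i)$; execute the compute phase of $ops_i$; if the move phase has a movement $M_i$, then: if $M_i$ is Contract or Pull, set $A$.parent to null and call Prune(); if $M_i$ is Push($p$), set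 parent to null and state to pruning for both $A$ and the neighbor at $p$; finally execute $M_i$. (2) An action $\alpha_{ED}$ whose guard is the disjunction of: $g_{GetPruned}$: $A$ is pruning; $g_{AskGrowth}$: $A$ is active and has an idle neighbor or asking child; $g_{GrowForest}$: $A$ is growing, or $A$ has state source and has an idle neighbor or asking child; $g_{HarvestEnergy}$: $A$ has state source and $A.e_{bat}<\kappa$; $g_{ShareEnergy}$: $A$ is neither idle nor pruning, $A.e_{bat}\ge1$, and $A$ has a child $B$ with $B.e_{bat}<\kappa$. Operations, in order, each block performed if its predicate holds: GetPruned: call Prune(). AskGrowth: set $A$.state to asking. GrowForest: for each idle neighbor, set its parent to point to $A$ and its state to active; set each asking child to growing; if $A$ is growing, set $A$.state to active. HarvestEnergy: increase $A.e_{bat}$ by 1. ShareEnergy: choose a child $B$ with $B.e_{bat}<\kappa$, decrease $A.e_{bat}$ by 1 and increase $B.e_{bat}$ by 1.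
   Formalization: The round bound is proved as O(n² max(1, T_A(n))): where T_A(n) = 0 the literal bound would be zero rounds, which is false because the sources must still fill their batteries; for T_A(n) ≥ 1 it is the stated bound. *)

theory Defs
  imports
    "HOL-Library.Numeral_Type"
    "HOL-Library.Product_Plus"
    "HOL-Library.Extended_Nat"
    "HOL-Library.Landau_Symbols"
begin

section \<open>The triangular lattice\<close>

text \<open>Nodes are given in axial coordinates; the direction \<open>d\<close> points along the angle
  \<open>d * 60\<close> degrees. Directions are integers modulo 6.\<close>

type_synonym node = "int \<times> int"
type_synonym dir = 6

definition dir_vec :: "dir \<Rightarrow> node" where
  "dir_vec d =
    (if d = 0 then (1, 0) else if d = 1 then (0, 1) else if d = 2 then (-1, 1)
     else if d = 3 then (-1, 0) else if d = 4 then (0, -1) else (1, -1))"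

definition adjacent :: "node \<Rightarrow> node \<Rightarrow> bool" where
  "adjacent u v \<longleftrightarrow> (\<exists>d. v = u + dir_vec d)"


section \<open>Amoebots and configurations\<close>

text \<open>An orientation is the global direction that the amoebot regards as its direction 0,
  together with its chirality (\<open>True\<close>: counter-clockwise).\<close>

type_synonym orientation = "dir \<times> bool"

definition global_dir :: "orientation \<Rightarrow> dir \<Rightarrow> dir" where
  "global_dir ori d = (if snd ori then fst ori + d else fst ori - d)"

datatype side = Head | Tail

text \<open>In \<open>Expanded h t\<close>, the head \<open>h\<close> is the node into which the amoebot expanded last.\<close>

datatype body = Contracted node | Expanded node node

fun nodes :: "body \<Rightarrow> node set" where
  "nodes (Contracted v) = {v}"
| "nodes (Expanded h t) = {h, t}"

text \<open>A port is labelled by the end of the amoebot at which it sits and by a local direction. A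
  contracted amoebot has the six ports \<open>(Tail, d)\<close>; an expanded amoebot has ten ports, namely all
  those that do not lead to its own other node. A contracted amoebot that expands keeps its old
  node as tail, so its old port labels stay attached to the same edges.\<close>

type_synonym port = "side \<times> dir"

fun port_node :: "orientation \<Rightarrow> body \<Rightarrow> port \<Rightarrow> node option" where
  "port_node ori (Contracted v) (Head, d) = None"
| "port_node ori (Contracted v) (Tail, d) = Some (v + dir_vec (global_dir ori d))"
| "port_node ori (Expanded h t) (Head, d) =
    (let w = h + dir_vec (global_dir ori d) in if w = t then None else Some w)"
| "port_node ori (Expanded h t) (Tail, d) =
    (let w = t + dir_vec (global_dir ori d) in if w = h then None else Some w)"

text \<open>The amoebots of a configuration \<open>c\<close> are named \<open>0, \<dots>, num c - 1\<close>; the names are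
  invisible to the algorithms. Values of the functions outside this range are irrelevant.\<close>

record 'm config =
  num :: nat
  orient :: "nat \<Rightarrow> orientation"
  body :: "nat \<Rightarrow> body"
  mem :: "nat \<Rightarrow> 'm"

definition occupied :: "'m config \<Rightarrow> node set" where
  "occupied c = (\<Union>a<num c. nodes (body c a))"

definition legal :: "'m config \<Rightarrow> bool" where
  "legal c \<longleftrightarrow>
    (\<forall>a<num c. \<forall>h t. body c a = Expanded h t \<longrightarrow> adjacent h t) \<and>
    (\<forall>a<num c. \<forall>b<num c. a \<noteq> b \<longrightarrow> nodes (body c a) \<inter> nodes (body c b) = {})"

definition connected_config :: "'m config \<Rightarrow> bool" where
  "connected_config c \<longleftrightarrow>
    (\<forall>u\<in>occupied c. \<forall>v\<in>occupied c.
      (u, v) \<in> {(x, y). x \<in> occupied c \<and> y \<in> occupied c \<and> adjacent x y}\<^sup>*)"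

definition neighbors :: "'m config \<Rightarrow> nat \<Rightarrow> nat set" where
  "neighbors c a =
    {b. b < num c \<and> b \<noteq> a \<and> (\<exists>u\<in>nodes (body c a). \<exists>v\<in>nodes (body c b). adjacent u v)}"

definition port_target :: "'m config \<Rightarrow> nat \<Rightarrow> port \<Rightarrow> node option" where
  "port_target c a p = port_node (orient c a) (body c a) p"

definition neighbor_at :: "'m config \<Rightarrow> nat \<Rightarrow> port \<Rightarrow> nat option" where
  "neighbor_at c a p =
    (case port_target c a p of
       None \<Rightarrow> None
     | Some v \<Rightarrow>
         if v \<in> occupied c then Some (THE b. b < num c \<and> v \<in> nodes (body c b)) else None)"


section \<open>Amoebot algorithms\<close>

text \<open>\<open>Contract s\<close> contracts into the end \<open>s\<close>. \<open>Pull p\<close> vacates the end at which the port \<open>p\<close>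
  sits.\<close>

datatype movement = Contract side | Expand port | Push port | Pull port

text \<open>Operation sequences interleaved with private computation: the continuation of
  \<open>Connected\<close> and \<open>Read\<close> is an arbitrary function of the value obtained. The port \<open>None\<close> stands
  for the amoebot itself. As this is an inductive datatype, each run is finite.\<close>

datatype 'm prog =
    Halt
  | Connected port "bool \<Rightarrow> 'm prog"
  | Read "port option" "'m \<Rightarrow> 'm prog"
  | Write "port option" 'm "'m prog"
  | Move movement "'m prog"
  | Lock "'m prog"
  | Unlock "'m prog"

text \<open>A guard sees the amoebot's own memory and, for each of its ports, whether the port is
  connected and, if so, the memory of the neighbor (\<open>None\<close>: no such port, \<open>Some None\<close>: not
  connected).\<close>

type_synonym 'm view = "'m \<times> (port \<Rightarrow> 'm option option)"

type_synonym 'm action = "('m view \<Rightarrow> bool) \<times> 'm prog"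

definition view :: "'m config \<Rightarrow> nat \<Rightarrow> 'm view" where
  "view c a =
    (mem c a,
     \<lambda>p. map_option (\<lambda>_. map_option (mem c) (neighbor_at c a p)) (port_target c a p))"

text \<open>The semantics of operations below is that of an amoebot \<open>a\<close> acting while all others are
  inactive; \<open>None\<close> means failure.\<close>

definition access :: "'m config \<Rightarrow> nat \<Rightarrow> port option \<Rightarrow> nat option" where
  "access c a q = (case q of None \<Rightarrow> Some a | Some p \<Rightarrow> neighbor_at c a p)"

fun exec_move :: "movement \<Rightarrow> nat \<Rightarrow> 'm config \<Rightarrow> 'm config option" where
  "exec_move (Contract s) a c =
    (case body c a of
       Contracted u \<Rightarrow> None
     | Expanded h t \<Rightarrow>
         Some (c\<lparr>body := (body c)(a := Contracted (case s of Head \<Rightarrow> h | Tail \<Rightarrow> t))\<rparr>))"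
| "exec_move (Expand p) a c =
    (case (body c a, port_target c a p) of
       (Contracted u, Some v) \<Rightarrow>
         if v \<in> occupied c then None else Some (c\<lparr>body := (body c)(a := Expanded v u)\<rparr>)
     | _ \<Rightarrow> None)"
| "exec_move (Push p) a c =
    (case (body c a, port_target c a p, neighbor_at c a p) of
       (Contracted u, Some v, Some b) \<Rightarrow>
         (case body c b of
            Contracted w \<Rightarrow> None
          | Expanded h t \<Rightarrow>
              Some (c\<lparr>body := (body c)(a := Expanded v u,
                                       b := Contracted (if v = h then t else h))\<rparr>))
     | _ \<Rightarrow> None)"
| "exec_move (Pull p) a c =
    (case (body c a, neighbor_at c a p) of
       (Expanded h t, Some b) \<Rightarrow>
         (case body c b of
            Contracted w \<Rightarrow>
              (let vacated = (case fst p of Head \<Rightarrow> h | Tail \<Rightarrow> t);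
                   kept = (case fst p of Head \<Rightarrow> t | Tail \<Rightarrow> h)
               in Some (c\<lparr>body := (body c)(a := Contracted kept, b := Expanded vacated w)\<rparr>))
          | Expanded h' t' \<Rightarrow> None)
     | _ \<Rightarrow> None)"

text \<open>Locks have no effect when all other amoebots are inactive.\<close>

primrec run :: "'m prog \<Rightarrow> nat \<Rightarrow> 'm config \<Rightarrow> 'm config option" where
  "run Halt a c = Some c"
| "run (Connected p k) a c =
    (if port_target c a p = None then None else run (k (neighbor_at c a p \<noteq> None)) a c)"
| "run (Read q k) a c =
    (case access c a q of None \<Rightarrow> None | Some b \<Rightarrow> run (k (mem c b)) a c)"
| "run (Write q m k) a c =
    (case access c a q of None \<Rightarrow> None | Some b \<Rightarrow> run k a (c\<lparr>mem := (mem c)(b := m)\<rparr>))"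
| "run (Move mv k) a c =
    (case exec_move mv a c of None \<Rightarrow> None | Some c' \<Rightarrow> run k a c')"
| "run (Lock k) a c = run k a c"
| "run (Unlock k) a c = run k a c"


section \<open>Sequential executions under an unfair adversary\<close>

text \<open>The meaning of an action as a guard and an execution relation on configurations. An
  amoebot algorithm and the algorithm obtained from it by the energy distribution framework are
  both interpreted as sets of such actions.\<close>

type_synonym 'm sem =
  "(('m config \<Rightarrow> nat \<Rightarrow> bool) \<times> ('m config \<Rightarrow> nat \<Rightarrow> 'm config \<Rightarrow> bool)) set"

definition sem_of :: "'m action set \<Rightarrow> 'm sem" where
  "sem_of A = (\<lambda>(g, ops). (\<lambda>c a. g (view c a), \<lambda>c a c'. run ops a c = Some c')) ` A"

definition enabled :: "'m sem \<Rightarrow> 'm config \<Rightarrow> nat \<Rightarrow> bool" where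
  "enabled S c a \<longleftrightarrow> a < num c \<and> (\<exists>(g, e)\<in>S. g c a)"

definition step :: "'m sem \<Rightarrow> 'm config \<Rightarrow> nat \<Rightarrow> 'm config \<Rightarrow> bool" where
  "step S c a c' \<longleftrightarrow> a < num c \<and> (\<exists>(g, e)\<in>S. g c a \<and> e c a c')"

text \<open>An execution is a maximal sequence of steps of length \<open>L\<close>, possibly infinite: \<open>C i\<close> is the
  configuration at time \<open>i\<close> and \<open>s i\<close> is the amoebot acting between times \<open>i\<close> and \<open>i + 1\<close>.
  (Values of \<open>C\<close> and \<open>s\<close> beyond the length are irrelevant.) A finite execution that gets stuck,
  because every action of every enabled amoebot would fail, counts as an execution but not as a
  terminating one.\<close>

definition execution :: "'m sem \<Rightarrow> (nat \<Rightarrow> 'm config) \<Rightarrow> (nat \<Rightarrow> nat) \<Rightarrow> enat \<Rightarrow> bool" where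
  "execution S C s L \<longleftrightarrow>
    (\<forall>i. enat i < L \<longrightarrow> step S (C i) (s i) (C (Suc i))) \<and>
    (\<forall>k. L = enat k \<longrightarrow> (\<nexists>a c'. step S (C k) a c'))"

definition terminates_at :: "'m sem \<Rightarrow> (nat \<Rightarrow> 'm config) \<Rightarrow> enat \<Rightarrow> nat \<Rightarrow> bool" where
  "terminates_at S C L k \<longleftrightarrow> L = enat k \<and> (\<forall>a. \<not> enabled S (C k) a)"

text \<open>Round \<open>i\<close> starts at time \<open>round_start S C s i\<close>; this is meaningful up to the time at which the execution
  terminates.\<close>

primrec round_start :: "'m sem \<Rightarrow> (nat \<Rightarrow> 'm config) \<Rightarrow> (nat \<Rightarrow> nat) \<Rightarrow> nat \<Rightarrow> nat" where
  "round_start S C s 0 = 0"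
| "round_start S C s (Suc i) =
    (LEAST t. round_start S C s i < t \<and>
      (\<forall>a. enabled S (C (round_start S C s i)) a \<longrightarrow>
        (\<exists>j. round_start S C s i < j \<and> j \<le> t \<and> (s (j - 1) = a \<or> \<not> enabled S (C j) a))))"

definition terminates_in_rounds ::
  "'m sem \<Rightarrow> (nat \<Rightarrow> 'm config) \<Rightarrow> (nat \<Rightarrow> nat) \<Rightarrow> enat \<Rightarrow> nat \<Rightarrow> bool" where
  "terminates_in_rounds S C s L r \<longleftrightarrow>
    (\<exists>k. terminates_at S C L k \<and> round_start S C s r = k)"


section \<open>Energy-compatible algorithms\<close>

primrec phase_structured :: "'m prog \<Rightarrow> bool" where
  "phase_structured Halt \<longleftrightarrow> True"
| "phase_structured (Connected p k) \<longleftrightarrow> (\<forall>x. phase_structured (k x))"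
| "phase_structured (Read q k) \<longleftrightarrow> (\<forall>x. phase_structured (k x))"
| "phase_structured (Write q m k) \<longleftrightarrow> phase_structured k"
| "phase_structured (Move mv k) \<longleftrightarrow> k = Halt"
| "phase_structured (Lock k) \<longleftrightarrow> False"
| "phase_structured (Unlock k) \<longleftrightarrow> False"

text \<open>\<open>Init\<close> is the set of initial configurations in which executions of \<open>A\<close> may start.\<close>

definition energy_compatible :: "'m config set \<Rightarrow> 'm action set \<Rightarrow> bool" where
  "energy_compatible Init A \<longleftrightarrow>
    (\<forall>C s L. C 0 \<in> Init \<and> execution (sem_of A) C s L \<longrightarrow> (\<exists>k. terminates_at (sem_of A) C L k)) \<and>
    (\<forall>c a. \<forall>(g, ops)\<in>A. legal c \<and> a < num c \<and> g (view c a) \<longrightarrow> run ops a c \<noteq> None) \<and>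
    (\<forall>(g, ops)\<in>A. phase_structured ops) \<and>
    (\<forall>c c'. legal c \<and> connected_config c \<and> (\<lambda>x y. \<exists>a. step (sem_of A) x a y)\<^sup>*\<^sup>* c c'
      \<longrightarrow> connected_config c')"


section \<open>The energy distribution framework\<close>

datatype estate = Source | Idle | Active | Asking | Growing | Pruning

text \<open>\<open>is_source\<close> marks the source amoebots. Unlike \<open>state\<close>, it never changes.\<close>

record 'm emem =
  base :: 'm
  is_source :: bool
  state :: estate
  parent :: "port option"
  ebat :: nat

definition erase :: "'m emem config \<Rightarrow> 'm config" where
  "erase c = \<lparr>num = num c, orient = orient c, body = body c, mem = (\<lambda>a. base (mem c a))\<rparr>"

definition energy_extension :: "'m config \<Rightarrow> 'm emem config \<Rightarrow> bool" where
  "energy_extension c d \<longleftrightarrow>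
    erase d = c \<and> (\<exists>a<num d. is_source (mem d a)) \<and>
    (\<forall>a<num d. state (mem d a) = (if is_source (mem d a) then Source else Idle) \<and>
               parent (mem d a) = None \<and> ebat (mem d a) = 0)"

definition children :: "'m emem config \<Rightarrow> nat \<Rightarrow> nat set" where
  "children c a =
    {b \<in> neighbors c a. \<exists>p. parent (mem c b) = Some p \<and> neighbor_at c b p = Some a}"

definition update_mem :: "nat \<Rightarrow> ('m \<Rightarrow> 'm) \<Rightarrow> 'm config \<Rightarrow> 'm config" where
  "update_mem a f c = c\<lparr>mem := (mem c)(a := f (mem c a))\<rparr>"

definition prune :: "nat \<Rightarrow> 'm emem config \<Rightarrow> 'm emem config" where
  "prune a c = c\<lparr>mem := (\<lambda>b.
     if b \<in> children c a then (mem c b)\<lparr>state := Pruning, parent := None\<rparr>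
     else if b = a then (mem c b)\<lparr>state := (if is_source (mem c b) then Source else Idle)\<rparr>
     else mem c b)\<rparr>"

subsection \<open>The actions obtained from the given algorithm\<close>

text \<open>Runs the compute phase and returns the movement decided upon, if any. This is used for
  phase-structured programs only.\<close>

primrec compute :: "'m prog \<Rightarrow> nat \<Rightarrow> 'm config \<Rightarrow> ('m config \<times> movement option) option" where
  "compute Halt a c = Some (c, None)"
| "compute (Connected p k) a c =
    (if port_target c a p = None then None else compute (k (neighbor_at c a p \<noteq> None)) a c)"
| "compute (Read q k) a c =
    (case access c a q of None \<Rightarrow> None | Some b \<Rightarrow> compute (k (mem c b)) a c)"
| "compute (Write q m k) a c =
    (case access c a q of None \<Rightarrow> None | Some b \<Rightarrow> compute k a (c\<lparr>mem := (mem c)(b := m)\<rparr>))"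
| "compute (Move mv k) a c = Some (c, Some mv)"
| "compute (Lock k) a c = compute k a c"
| "compute (Unlock k) a c = compute k a c"

text \<open>Since a compute phase of the given algorithm accesses only the \<open>base\<close> part of the memories,
  it is run on the erased configuration and its result is copied back.\<close>

definition copy_base :: "'m config \<Rightarrow> 'm emem config \<Rightarrow> 'm emem config" where
  "copy_base c d = d\<lparr>mem := (\<lambda>b. (mem d b)\<lparr>base := mem c b\<rparr>)\<rparr>"

definition before_move :: "movement \<Rightarrow> nat \<Rightarrow> 'm emem config \<Rightarrow> 'm emem config" where
  "before_move mv a c =
    (case mv of
       Contract s \<Rightarrow> prune a (update_mem a (\<lambda>m. m\<lparr>parent := None\<rparr>) c)
     | Pull p \<Rightarrow> prune a (update_mem a (\<lambda>m. m\<lparr>parent := None\<rparr>) c)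
     | Push p \<Rightarrow>
         (let detach = (\<lambda>m. m\<lparr>parent := None, state := Pruning\<rparr>);
              c' = update_mem a detach c
          in case neighbor_at c a p of None \<Rightarrow> c' | Some b \<Rightarrow> update_mem b detach c')
     | Expand p \<Rightarrow> c)"

definition energy_guard ::
  "('m view \<Rightarrow> bool) \<Rightarrow> nat \<Rightarrow> 'm emem config \<Rightarrow> nat \<Rightarrow> bool" where
  "energy_guard g demand c a \<longleftrightarrow>
    g (view (erase c) a) \<and> ebat (mem c a) \<ge> demand \<and>
    (\<forall>b \<in> neighbors c a \<union> {a}. state (mem c b) \<notin> {Idle, Pruning})"

definition energy_exec ::
  "'m prog \<Rightarrow> nat \<Rightarrow> 'm emem config \<Rightarrow> nat \<Rightarrow> 'm emem config \<Rightarrow> bool" where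
  "energy_exec ops demand c a c' \<longleftrightarrow>
    (let c1 = update_mem a (\<lambda>m. m\<lparr>ebat := ebat m - demand\<rparr>) c
     in \<exists>b mv. compute ops a (erase c1) = Some (b, mv) \<and>
          (case mv of
             None \<Rightarrow> c' = copy_base b c1
           | Some m \<Rightarrow> exec_move m a (before_move m a (copy_base b c1)) = Some c'))"

subsection \<open>The energy distribution action\<close>

definition idle_neighbors :: "'m emem config \<Rightarrow> nat \<Rightarrow> nat set" where
  "idle_neighbors c a = {b \<in> neighbors c a. state (mem c b) = Idle}"

definition asking_children :: "'m emem config \<Rightarrow> nat \<Rightarrow> nat set" where
  "asking_children c a = {b \<in> children c a. state (mem c b) = Asking}"

definition g_get_pruned :: "'m emem config \<Rightarrow> nat \<Rightarrow> bool" where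
  "g_get_pruned c a \<longleftrightarrow> state (mem c a) = Pruning"

definition g_ask_growth :: "'m emem config \<Rightarrow> nat \<Rightarrow> bool" where
  "g_ask_growth c a \<longleftrightarrow>
    state (mem c a) = Active \<and> (idle_neighbors c a \<noteq> {} \<or> asking_children c a \<noteq> {})"

definition g_grow_forest :: "'m emem config \<Rightarrow> nat \<Rightarrow> bool" where
  "g_grow_forest c a \<longleftrightarrow>
    state (mem c a) = Growing \<or>
    (state (mem c a) = Source \<and> (idle_neighbors c a \<noteq> {} \<or> asking_children c a \<noteq> {}))"

definition g_harvest_energy :: "nat \<Rightarrow> 'm emem config \<Rightarrow> nat \<Rightarrow> bool" where
  "g_harvest_energy \<kappa> c a \<longleftrightarrow> state (mem c a) = Source \<and> ebat (mem c a) < \<kappa>"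

definition g_share_energy :: "nat \<Rightarrow> 'm emem config \<Rightarrow> nat \<Rightarrow> bool" where
  "g_share_energy \<kappa> c a \<longleftrightarrow>
    state (mem c a) \<notin> {Idle, Pruning} \<and> ebat (mem c a) \<ge> 1 \<and>
    (\<exists>b\<in>children c a. ebat (mem c b) < \<kappa>)"

text \<open>An idle neighbor that is adjacent to \<open>a\<close> along several edges may be given any of the ports
  leading to \<open>a\<close> as its parent port; \<open>f\<close> makes this choice.\<close>

definition grow_forest :: "'m emem config \<Rightarrow> nat \<Rightarrow> 'm emem config \<Rightarrow> bool" where
  "grow_forest c a c' \<longleftrightarrow>
    (\<exists>f. (\<forall>b\<in>idle_neighbors c a. neighbor_at c b (f b) = Some a) \<and>
      c' = c\<lparr>mem := (\<lambda>b.
        if b \<in> idle_neighbors c a then (mem c b)\<lparr>parent := Some (f b), state := Active\<rparr>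
        else if b \<in> asking_children c a then (mem c b)\<lparr>state := Growing\<rparr>
        else if b = a \<and> state (mem c a) = Growing then (mem c b)\<lparr>state := Active\<rparr>
        else mem c b)\<rparr>)"

definition share_energy :: "nat \<Rightarrow> 'm emem config \<Rightarrow> nat \<Rightarrow> 'm emem config \<Rightarrow> bool" where
  "share_energy \<kappa> c a c' \<longleftrightarrow>
    (\<exists>b\<in>children c a. ebat (mem c b) < \<kappa> \<and>
      c' = update_mem b (\<lambda>m. m\<lparr>ebat := ebat m + 1\<rparr>)
             (update_mem a (\<lambda>m. m\<lparr>ebat := ebat m - 1\<rparr>) c))"

definition ed_guard :: "nat \<Rightarrow> 'm emem config \<Rightarrow> nat \<Rightarrow> bool" where
  "ed_guard \<kappa> c a \<longleftrightarrow>
    g_get_pruned c a \<or> g_ask_growth c a \<or> g_grow_forest c a \<or>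
    g_harvest_energy \<kappa> c a \<or> g_share_energy \<kappa> c a"

text \<open>The predicate of each block is evaluated when the block is reached.\<close>

definition ed_exec :: "nat \<Rightarrow> 'm emem config \<Rightarrow> nat \<Rightarrow> 'm emem config \<Rightarrow> bool" where
  "ed_exec \<kappa> c a c' \<longleftrightarrow>
    (\<exists>c1 c2 c3 c4.
      c1 = (if g_get_pruned c a then prune a c else c) \<and>
      c2 = (if g_ask_growth c1 a then update_mem a (\<lambda>m. m\<lparr>state := Asking\<rparr>) c1 else c1) \<and>
      (if g_grow_forest c2 a then grow_forest c2 a c3 else c3 = c2) \<and>
      c4 = (if g_harvest_energy \<kappa> c3 a then update_mem a (\<lambda>m. m\<lparr>ebat := ebat m + 1\<rparr>) c3
            else c3) \<and>
      (if g_share_energy \<kappa> c4 a then share_energy \<kappa> c4 a c' else c' = c4))"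

definition energy_framework ::
  "nat \<Rightarrow> ('m action \<Rightarrow> nat) \<Rightarrow> 'm action set \<Rightarrow> 'm emem sem" where
  "energy_framework \<kappa> \<delta> A =
    (\<lambda>(g, ops). (energy_guard g (\<delta> (g, ops)), energy_exec ops (\<delta> (g, ops)))) ` A
    \<union> {(ed_guard \<kappa>, ed_exec \<kappa>)}"

end

theory Submission
  imports Defs
begin

text \<open>
  Parent pointers always form a forest whose non-idle roots are source or pruning amoebots. Without
  idle or pruning amoebots all of it hangs on sources, so a terminal configuration of the framework
  has no idle amoebot (by connectivity) and all batteries are full; hence only the guards of the given
  algorithm can have disabled its actions, and forgetting the energy variables yields a terminating
  execution of it.

  For the bound, consider a stretch without actions of the given algorithm. Call an amoebot unstable
  if its root is pruning. The maximum over unstable amoebots of their depth plus the number of their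
  growing ancestors never increases and drops in every round, so after \<open>2n\<close> rounds nothing is
  unstable. From then on every step decreases a potential of size \<open>O(n\<^sup>2)\<close>, composed of the
  outstanding calls for growth and the missing energy, both weighted by depth. So any
  \<open>O(n\<^sup>2)\<close> consecutive rounds contain an action of the given algorithm. Finiteness under the unfair
  adversary, who may postpone pruning forever, follows since the potential decreases
  lexicographically once it is preceded by \<open>\<Sum> n^(number of growing ancestors)\<close> over the unstable
  amoebots.
\<close>

section \<open>Forests\<close>

text \<open>Two different clocks are needed. While unstable trees exist, pruned amoebots turn idle
  and may be adopted again by growing amoebots of trees that are not yet pruned, which undoes
  progress in \<open>work\<close> and \<open>stored\<close>. The only step-wise measure for this
  regime, \<open>unrest\<close>, can be exponential in n and is fit for termination only; the
  polynomial bound comes from \<open>level\<close>, which starts at 2n at most but drops only once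
  every pruning root present at the start of a round has acted. Without unstable amoebots the
  potential drops in every single step, and a round contains at least one step.

  Actions of the given algorithm may increase every measure. This is harmless: the bounds 2n on
  levels and \<open>(11 + \<kappa>) * n^2\<close> on the potential hold in each sound configuration
  whatever its history, so the count restarts after each such action. What these actions must
  preserve is only the forest itself, and the delicate case is a push, which hands a node with
  attached children from one amoebot to another.\<close>

definition up :: "(nat \<Rightarrow> nat option) \<Rightarrow> nat \<Rightarrow> nat set" where
  "up pa v = {u. (v, u) \<in> {(x, y). pa x = Some y}\<^sup>*}"

definition asum :: "(nat \<Rightarrow> nat option) \<Rightarrow> (nat \<Rightarrow> nat) \<Rightarrow> nat \<Rightarrow> nat" where
  "asum pa f v = sum f (up pa v)"

text \<open>The amoebot itself is counted, so a root has depth 1. As a weight, depth is thus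
  strictly positive: energy harvested at a root counts, and no unstable amoebot fits at level
  0.\<close>

abbreviation dep :: "(nat \<Rightarrow> nat option) \<Rightarrow> nat \<Rightarrow> nat" where
  "dep pa \<equiv> asum pa (\<lambda>_. 1)"

abbreviation growers :: "(nat \<Rightarrow> estate) \<Rightarrow> (nat \<Rightarrow> nat option) \<Rightarrow> nat \<Rightarrow> nat" where
  "growers st pa \<equiv> asum pa (\<lambda>u. of_bool (st u = Growing))"

definition unstable :: "(nat \<Rightarrow> estate) \<Rightarrow> (nat \<Rightarrow> nat option) \<Rightarrow> nat \<Rightarrow> bool" where
  "unstable st pa v \<longleftrightarrow> (\<exists>u\<in>up pa v. st u = Pruning)"

lemma up_None: "pa v = None \<Longrightarrow> up pa v = {v}"
  by (auto simp: up_def elim: converse_rtranclE)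

lemma up_Some: "pa v = Some u \<Longrightarrow> up pa v = insert v (up pa u)"
  by (auto simp: up_def elim: converse_rtranclE intro: converse_rtrancl_into_rtrancl)

lemma self_in_up: "v \<in> up pa v"
  by (simp add: up_def)

text \<open>Abstracting from configurations lets the effect of each block be computed on
  \<open>st\<close> and \<open>pa\<close> alone. A source may be \<open>Pruning\<close> because a
  push detaches both participants. Acyclicity is given by a rank: this yields induction from the
  roots downwards, and each change of the forest preserves it by exhibiting a suitable rank.\<close>

locale forest =
  fixes n :: nat and src :: "nat \<Rightarrow> bool" and st :: "nat \<Rightarrow> estate"
    and pa :: "nat \<Rightarrow> nat option"
  assumes source_state: "v < n \<Longrightarrow> src v \<Longrightarrow> st v \<in> {Source, Pruning}"
    and nonsource_state: "v < n \<Longrightarrow> \<not> src v \<Longrightarrow> st v \<noteq> Source"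
    and root_iff: "v < n \<Longrightarrow> pa v = None \<longleftrightarrow> st v \<in> {Source, Idle, Pruning}"
    and parent: "pa v = Some u \<Longrightarrow> v < n \<and> u < n \<and> st u \<noteq> Idle"
    and ranked: "\<exists>f :: nat \<Rightarrow> nat. \<forall>v u. pa v = Some u \<longrightarrow> f u < f v"
begin

lemma ancestor_induct [case_names step]:
  assumes "\<And>v. (\<And>u. pa v = Some u \<Longrightarrow> P u) \<Longrightarrow> P v"
  shows "P v"
proof -
  obtain f :: "nat \<Rightarrow> nat" where f: "\<And>v u. pa v = Some u \<Longrightarrow> f u < f v"
    using ranked by blast
  show ?thesis
    by (induction v rule: measure_induct_rule[of f]) (auto intro: assms f)
qed

lemma up_subset: "up pa v \<subseteq> insert v {..<n}"
proof (induction v rule: ancestor_induct)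
  case (step v)
  then show ?case using parent by (cases "pa v") (fastforce simp: up_None up_Some)+
qed

lemma finite_up: "finite (up pa v)"
  using up_subset by (rule finite_subset) simp

lemma not_in_up_parent: assumes "pa v = Some u" shows "v \<notin> up pa u"
proof -
  obtain f :: "nat \<Rightarrow> nat" where f: "\<And>v u. pa v = Some u \<Longrightarrow> f u < f v"
    using ranked by blast
  have "f w \<le> f u" if "w \<in> up pa u" for w
    using that unfolding up_def mem_Collect_eq
    by (induction rule: rtrancl_induct) (use f in fastforce)+
  with f[OF assms] show ?thesis by force
qed

lemma asum_None: "pa v = None \<Longrightarrow> asum pa f v = f v"
  by (simp add: asum_def up_None)

lemma asum_Some: "pa v = Some u \<Longrightarrow> asum pa f v = f v + asum pa f u"
  using not_in_up_parent finite_up by (simp add: asum_def up_Some)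

lemma asum_le: assumes "v < n" "\<And>u. f u \<le> 1" shows "asum pa f v \<le> n"
proof -
  have "asum pa f v \<le> (\<Sum>u\<in>up pa v. 1)"
    unfolding asum_def by (rule sum_mono) (use assms in auto)
  also have "\<dots> \<le> card {..<n}"
    using up_subset[of v] assms(1) by (simp add: card_mono insert_absorb del: card_lessThan)
  finally show ?thesis by simp
qed

lemma dep_pos: "0 < dep pa v"
  using finite_up[of v] self_in_up[of v] by (auto simp: asum_def card_gt_0_iff)

lemma unstable_None: "pa v = None \<Longrightarrow> unstable st pa v \<longleftrightarrow> st v = Pruning"
  by (simp add: unstable_def up_None)

text \<open>By \<open>root_iff\<close> an amoebot with a parent is never \<open>Pruning\<close>, so
  the root of the tree alone decides.\<close>

lemma unstable_Some: "pa v = Some u \<Longrightarrow> unstable st pa v \<longleftrightarrow> unstable st pa u"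
  using root_iff[of v] parent[of v u] by (auto simp: unstable_def up_Some)

text \<open>Pruning amoebots are roots, and a path upwards meets only one root. This caps the
  allowance granted through \<open>Q\<close> in \<open>level\<close>.\<close>

lemma asum_pruning_le_1:
  assumes "\<And>u. u \<in> Q \<Longrightarrow> st u = Pruning"
  shows "asum pa (\<lambda>u. of_bool (u \<in> Q)) v \<le> 1"
proof (induction v rule: ancestor_induct)
  case (step v)
  show ?case
  proof (cases "pa v")
    case (Some u)
    then have "v \<notin> Q" using root_iff[of v] parent[of v u] assms by auto
    then show ?thesis using step Some by (simp add: asum_Some)
  qed (simp add: asum_None)
qed

lemma childless_if_idle: "st v = Idle \<Longrightarrow> pa u \<noteq> Some v"
  using parent by auto

end

text \<open>The base \<open>n\<close> makes up for adoptions: a growing amoebot that adopts fewer than \<open>n\<close> amoebots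
  hands its weight on to itself and them, each with one growing ancestor less.\<close>

definition unrest :: "nat \<Rightarrow> (nat \<Rightarrow> estate) \<Rightarrow> (nat \<Rightarrow> nat option) \<Rightarrow> nat" where
  "unrest n st pa = (\<Sum>v<n. if unstable st pa v then n ^ growers st pa v else 0)"

text \<open>A growing amoebot in an unstable tree may extend that tree by one layer, so only the sum of
  depth and number of growing ancestors cannot increase. \<open>Q\<close> is the set of roots that have yet to
  act in the current round; each of them lowers its whole tree when it does.\<close>

definition level ::
    "nat \<Rightarrow> (nat \<Rightarrow> estate) \<Rightarrow> (nat \<Rightarrow> nat option) \<Rightarrow> nat set \<Rightarrow> nat \<Rightarrow> bool" where
  "level n st pa Q K \<longleftrightarrow> (\<forall>q\<in>Q. st q = Pruning) \<and>
    (\<forall>v<n. unstable st pa v \<longrightarrow>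
      dep pa v + growers st pa v \<le> K + asum pa (\<lambda>u. of_bool (u \<in> Q)) v)"

section \<open>Pruning\<close>

text \<open>The parent of \<open>x\<close> itself is cleared too: a pruning \<open>x\<close> has
  none, and before a contraction or a pull the framework clears it ahead of \<open>Prune()\<close>.
  One description thus serves both uses.\<close>

definition pruned_st ::
    "(nat \<Rightarrow> bool) \<Rightarrow> (nat \<Rightarrow> estate) \<Rightarrow> (nat \<Rightarrow> nat option) \<Rightarrow> nat \<Rightarrow> nat \<Rightarrow> estate" where
  "pruned_st src st pa x v =
    (if pa v = Some x then Pruning else if v = x then (if src x then Source else Idle) else st v)"

definition pruned_pa :: "(nat \<Rightarrow> nat option) \<Rightarrow> nat \<Rightarrow> nat \<Rightarrow> nat option" where
  "pruned_pa pa x v = (if v = x \<or> pa v = Some x then None else pa v)"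

lemma pruned_pa_None: "v = x \<or> pa v = Some x \<Longrightarrow> pruned_pa pa x v = None"
  by (simp add: pruned_pa_def)

lemma pruned_pa_other: "v \<noteq> x \<Longrightarrow> pa v \<noteq> Some x \<Longrightarrow> pruned_pa pa x v = pa v"
  by (simp add: pruned_pa_def)

context forest
begin

lemma no_self_parent: "pa v \<noteq> Some v"
  using ranked by (metis less_irrefl)

lemma forest_pruned:
  assumes "x < n"
  shows "forest n src (pruned_st src st pa x) (pruned_pa pa x)"
proof
  fix v assume "v < n"
  show "pruned_st src st pa x v \<in> {Source, Pruning}" if "src v"
    using source_state[OF \<open>v < n\<close> that] that by (auto simp: pruned_st_def)
  show "pruned_st src st pa x v \<noteq> Source" if "\<not> src v"
    using nonsource_state[OF \<open>v < n\<close> that] that by (auto simp: pruned_st_def)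
  show "pruned_pa pa x v = None \<longleftrightarrow> pruned_st src st pa x v \<in> {Source, Idle, Pruning}"
    using root_iff[OF \<open>v < n\<close>] by (auto simp: pruned_st_def pruned_pa_def)
next
  fix v u assume "pruned_pa pa x v = Some u"
  then show "v < n \<and> u < n \<and> pruned_st src st pa x u \<noteq> Idle"
    using parent[of v u] by (auto simp: pruned_st_def pruned_pa_def split: if_splits)
next
  show "\<exists>f :: nat \<Rightarrow> nat. \<forall>v u. pruned_pa pa x v = Some u \<longrightarrow> f u < f v"
    using ranked by (auto simp: pruned_pa_def)
qed

context
  fixes x :: nat
  assumes x: "x < n" "st x = Pruning"
begin

interpretation P: forest n src "pruned_st src st pa x" "pruned_pa pa x"
  using forest_pruned x by simp

lemma pa_x: "pa x = None"
  using root_iff x by simp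

text \<open>As \<open>x\<close> is a root, cutting it off removes exactly the term of
  \<open>x\<close> from the sums of its descendants. Nothing changes if this term is 0 or the path
  avoids \<open>x\<close>; for \<open>dep\<close> the term is 1, which is
  \<open>dep_pruned\<close>.\<close>

lemma asum_pruned:
  assumes "f x = 0 \<or> x \<notin> up pa v"
  shows "asum (pruned_pa pa x) f v = asum pa f v"
  using assms
proof (induction v rule: ancestor_induct)
  case (step v)
  consider "v = x" | "pa v = Some x" | u where "v \<noteq> x" "pa v = Some u" "u \<noteq> x" | "v \<noteq> x" "pa v = None"
    by (cases "pa v") auto
  then show ?case
    using step pa_x
    by cases (auto simp: pruned_pa_None pruned_pa_other asum_None asum_Some P.asum_None P.asum_Some up_Some up_None
      self_in_up)
qed

lemma dep_pruned:
  assumes "x \<in> up pa v" "v \<noteq> x"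
  shows "dep pa v = Suc (dep (pruned_pa pa x) v)"
  using assms
proof (induction v rule: ancestor_induct)
  case (step v)
  consider "pa v = Some x" | u where "v \<noteq> x" "pa v = Some u" "u \<noteq> x" | "v \<noteq> x" "pa v = None"
    using step by (cases "pa v") auto
  then show ?case
    using step pa_x
    by cases (auto simp: pruned_pa_None pruned_pa_other asum_None asum_Some P.asum_None P.asum_Some up_Some up_None)
qed

lemma growers_pruned:
  "growers (pruned_st src st pa x) (pruned_pa pa x) v \<le> growers st pa v"
proof -
  have "growers (pruned_st src st pa x) (pruned_pa pa x) v \<le> growers st (pruned_pa pa x) v"
    unfolding asum_def by (rule sum_mono) (auto simp: pruned_st_def)
  then show ?thesis using asum_pruned[of "\<lambda>u. of_bool (st u = Growing)"] x by simp
qed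

text \<open>The children of \<open>x\<close> become pruning roots, so everything below
  \<open>x\<close> stays unstable; \<open>x\<close> alone escapes, as it turns idle or
  source.\<close>

lemma unstable_pruned:
  "unstable (pruned_st src st pa x) (pruned_pa pa x) v \<longleftrightarrow> v \<noteq> x \<and> unstable st pa v"
proof (induction v rule: ancestor_induct)
  case (step v)
  consider "v = x" | "pa v = Some x" | u where "v \<noteq> x" "pa v = Some u" "u \<noteq> x" | "v \<noteq> x" "pa v = None"
    by (cases "pa v") auto
  then show ?case
  proof cases
    case 2
    then have "unstable (pruned_st src st pa x) (pruned_pa pa x) v"
      by (simp add: P.unstable_None[OF pruned_pa_None] pruned_st_def)
    with 2 show ?thesis using x pa_x unstable_Some[of v x] unstable_None[of x] by auto
  next
    case 3
    then show ?thesis using step[of u] P.unstable_Some[of v u] unstable_Some[of v u]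
      by (simp add: pruned_pa_other)
  qed (use x pa_x in \<open>simp_all add: P.unstable_None[OF pruned_pa_None] P.unstable_None pruned_pa_other
      unstable_None, simp_all add: pruned_st_def\<close>)
qed

text \<open>No summand grows, and the positive summand of \<open>x\<close> disappears.\<close>

lemma unrest_pruned:
  "unrest n (pruned_st src st pa x) (pruned_pa pa x) < unrest n st pa"
  unfolding unrest_def
proof (rule sum_strict_mono_ex1)
  have "1 \<le> n" using x by simp
  then show "\<forall>v\<in>{..<n}. (if unstable (pruned_st src st pa x) (pruned_pa pa x) v
      then n ^ growers (pruned_st src st pa x) (pruned_pa pa x) v else 0)
      \<le> (if unstable st pa v then n ^ growers st pa v else 0)"
    using growers_pruned by (auto simp: unstable_pruned intro: power_increasing)
  show "\<exists>v\<in>{..<n}. (if unstable (pruned_st src st pa x) (pruned_pa pa x) v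
      then n ^ growers (pruned_st src st pa x) (pruned_pa pa x) v else 0)
      < (if unstable st pa v then n ^ growers st pa v else 0)"
    using x pa_x by (intro bexI[of _ x]) (auto simp: unstable_pruned unstable_None)
qed simp

text \<open>Below \<open>x\<close>, the depth drops by one. This pays for the allowance of at most 1
  held before, so the bound \<open>K\<close> now holds outright, although the new root need not be
  in \<open>Q\<close>. All other paths are untouched.\<close>

lemma level_pruned:
  assumes "level n st pa Q K"
  shows "level n (pruned_st src st pa x) (pruned_pa pa x) (Q - {x}) K"
  unfolding level_def
proof (intro conjI ballI allI impI)
  have Q: "\<And>q. q \<in> Q \<Longrightarrow> st q = Pruning" using assms by (simp add: level_def)
  show "pruned_st src st pa x q = Pruning" if "q \<in> Q - {x}" for q
    using Q that by (auto simp: pruned_st_def)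
  fix v assume v: "v < n" "unstable (pruned_st src st pa x) (pruned_pa pa x) v"
  then have v': "v \<noteq> x" "unstable st pa v" by (simp_all add: unstable_pruned)
  with assms v have old: "dep pa v + growers st pa v \<le> K + asum pa (\<lambda>u. of_bool (u \<in> Q)) v"
    by (simp add: level_def)
  show "dep (pruned_pa pa x) v + growers (pruned_st src st pa x) (pruned_pa pa x) v
    \<le> K + asum (pruned_pa pa x) (\<lambda>u. of_bool (u \<in> Q - {x})) v"
  proof (cases "x \<in> up pa v")
    case True
    then show ?thesis
      using dep_pruned[OF True v'(1)] growers_pruned[of v] old asum_pruning_le_1[of Q v] Q by simp
  next
    case False
    have "asum pa (\<lambda>u. of_bool (u \<in> Q)) v = asum pa (\<lambda>u. of_bool (u \<in> Q - {x})) v"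
      unfolding asum_def using False by (intro sum.cong) auto
    then show ?thesis
      using False growers_pruned[of v] old asum_pruned[of _ v] by simp
  qed
qed

end

end

section \<open>Growth and adoption, and the measures of outstanding work\<close>

definition adopted :: "nat set \<Rightarrow> (nat \<Rightarrow> estate) \<Rightarrow> nat set" where
  "adopted N st = {v \<in> N. st v = Idle}"

definition grown_st ::
    "nat set \<Rightarrow> (nat \<Rightarrow> estate) \<Rightarrow> (nat \<Rightarrow> nat option) \<Rightarrow> nat \<Rightarrow> nat \<Rightarrow> estate" where
  "grown_st N st pa x v =
    (if v \<in> adopted N st then Active
     else if pa v = Some x \<and> st v = Asking then Growing
     else if v = x \<and> st x = Growing then Active else st v)"

definition grown_pa ::
    "nat set \<Rightarrow> (nat \<Rightarrow> estate) \<Rightarrow> (nat \<Rightarrow> nat option) \<Rightarrow> nat \<Rightarrow> nat \<Rightarrow> nat option" where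
  "grown_pa N st pa x v = (if v \<in> adopted N st then Some x else pa v)"

lemma grown_pa_adopted: "v \<in> adopted N st \<Longrightarrow> grown_pa N st pa x v = Some x"
  by (simp add: grown_pa_def)

lemma grown_pa_other: "v \<notin> adopted N st \<Longrightarrow> grown_pa N st pa x v = pa v"
  by (simp add: grown_pa_def)

text \<open>\<open>calls nb st pa y\<close> is the number of reasons that \<open>y\<close> has to ask for growth. A call travels to
  the root, so it is weighted with the depth of \<open>y\<close> in \<open>work\<close>. An idle amoebot may still become the
  origin of one call, at depth at most \<open>n\<close>.\<close>

definition calls ::
    "(nat \<Rightarrow> nat set) \<Rightarrow> (nat \<Rightarrow> estate) \<Rightarrow> (nat \<Rightarrow> nat option) \<Rightarrow> nat \<Rightarrow> nat" where
  "calls nb st pa y =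
    (if st y \<in> {Active, Source}
     then of_bool (adopted (nb y) st \<noteq> {}) + card {b. pa b = Some y \<and> st b = Asking} else 0)"

text \<open>An asking amoebot has two moves ahead: being told to grow, and growing.\<close>

definition phase :: "estate \<Rightarrow> nat" where
  "phase s = (case s of Asking \<Rightarrow> 2 | Growing \<Rightarrow> 1 | _ \<Rightarrow> 0)"

text \<open>The factor 3 exceeds by one the cost 2 in \<open>phase\<close> of passing a call one
  level up. An idle amoebot therefore reserves 3 times the largest possible depth.\<close>

definition work ::
    "nat \<Rightarrow> (nat \<Rightarrow> nat set) \<Rightarrow> (nat \<Rightarrow> estate) \<Rightarrow> (nat \<Rightarrow> nat option) \<Rightarrow> nat" where
  "work n nb st pa = 3 * (\<Sum>y<n. calls nb st pa y * dep pa y) + (\<Sum>y<n. phase (st y))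
    + 3 * (n * card {y. y < n \<and> st y = Idle})"

text \<open>With depth as weight, a transfer to a child counts as progress just as a harvest
  does.\<close>

definition stored :: "nat \<Rightarrow> (nat \<Rightarrow> nat option) \<Rightarrow> (nat \<Rightarrow> nat) \<Rightarrow> nat" where
  "stored n pa eb = (\<Sum>v<n. eb v * dep pa v)"

context forest
begin

lemma finite_children: "finite {b. pa b = Some y \<and> R b}"
  by (rule finite_subset[of _ "{..<n}"]) (use parent in auto)

text \<open>Each asking amoebot is counted at its unique parent only, and each amoebot adds at most
  one for its idle neighbors.\<close>

lemma sum_calls: "(\<Sum>y<n. calls nb st pa y) \<le> 2 * n"
proof -
  have "(\<Sum>y<n. calls nb st pa y) \<le> (\<Sum>y<n. 1 + card {b. pa b = Some y \<and> st b = Asking})"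
    by (rule sum_mono) (simp add: calls_def)
  also have "\<dots> = n + (\<Sum>y<n. card {b. pa b = Some y \<and> st b = Asking})"
    by (subst sum.distrib) simp
  also have "(\<Sum>y<n. card {b. pa b = Some y \<and> st b = Asking})
      = card (\<Union>y<n. {b. pa b = Some y \<and> st b = Asking})"
    by (subst card_UN_disjoint) (auto simp: finite_children)
  also have "\<dots> \<le> card {..<n}"
    by (rule card_mono) (use parent in auto)
  finally show ?thesis by simp
qed

text \<open>The constant is 11 = 3 * 2 + 2 + 3, one summand for each part of
  \<open>work\<close>.\<close>

lemma work_le: "work n nb st pa \<le> 11 * n\<^sup>2"
proof -
  have "(\<Sum>y<n. calls nb st pa y * dep pa y) \<le> (\<Sum>y<n. calls nb st pa y * n)"
    by (intro sum_mono mult_le_mono asum_le) auto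
  also have "\<dots> \<le> 2 * n * n"
    unfolding sum_distrib_right[symmetric] using sum_calls by (rule mult_right_mono) simp
  finally have 1: "(\<Sum>y<n. calls nb st pa y * dep pa y) \<le> 2 * n\<^sup>2" by (simp add: power2_eq_square)
  have "(\<Sum>y<n. phase (st y)) \<le> (\<Sum>y<n. 2)"
    by (rule sum_mono) (simp add: phase_def split: estate.split)
  then have 2: "(\<Sum>y<n. phase (st y)) \<le> 2 * n" by simp
  have "card {y. y < n \<and> st y = Idle} \<le> card {..<n}" by (rule card_mono) auto
  then have 3: "n * card {y. y < n \<and> st y = Idle} \<le> n\<^sup>2" by (simp add: power2_eq_square)
  have "n \<le> n\<^sup>2" by (simp add: power2_eq_square)
  with 1 2 3 show ?thesis unfolding work_def by linarith
qed

lemma stored_le: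
  assumes "\<And>v. v < n \<Longrightarrow> eb v \<le> \<kappa>"
  shows "stored n pa eb \<le> \<kappa> * n\<^sup>2"
proof -
  have "stored n pa eb \<le> (\<Sum>v<n. \<kappa> * n)"
    unfolding stored_def by (intro sum_mono mult_le_mono asum_le assms) auto
  then show ?thesis by (simp add: power2_eq_square algebra_simps)
qed

context
  fixes x :: nat and N :: "nat set"
  assumes x: "x < n" "st x = Growing \<or> st x = Source" and N: "N \<subseteq> {..<n}" "x \<notin> N"
begin

lemma x_not_adopted: "x \<notin> adopted N st"
  using N by (simp add: adopted_def)

text \<open>Idle amoebots are isolated in the forest, so an adoption attaches single nodes and never
  whole trees.\<close>

lemma adopted_root: "v \<in> adopted N st \<Longrightarrow> pa v = None \<and> pa u \<noteq> Some v \<and> v < n \<and> \<not> src v"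
  using N root_iff[of v] childless_if_idle[of v u] source_state[of v] by (auto simp: adopted_def)

lemma finite_adopted: "finite (adopted N st)"
  using N by (auto simp: adopted_def intro: finite_subset)

lemma forest_grown: "forest n src (grown_st N st pa x) (grown_pa N st pa x)"
proof
  fix v assume "v < n"
  show "grown_st N st pa x v \<in> {Source, Pruning}" if "src v"
    using source_state[OF \<open>v < n\<close> that] adopted_root[of v] that by (auto simp: grown_st_def)
  show "grown_st N st pa x v \<noteq> Source" if "\<not> src v"
    using nonsource_state[OF \<open>v < n\<close> that] that by (auto simp: grown_st_def)
  show "grown_pa N st pa x v = None \<longleftrightarrow> grown_st N st pa x v \<in> {Source, Idle, Pruning}"
    using root_iff[OF \<open>v < n\<close>] by (auto simp: grown_st_def grown_pa_def)
next
  fix v u assume "grown_pa N st pa x v = Some u"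
  then show "v < n \<and> u < n \<and> grown_st N st pa x u \<noteq> Idle"
    using parent[of v u] adopted_root[of v] x by (auto simp: grown_st_def grown_pa_def split: if_splits)
next
  obtain f :: "nat \<Rightarrow> nat" where f: "\<And>v u. pa v = Some u \<Longrightarrow> f u < f v"
    using ranked by blast
  \<comment> \<open>Adopted amoebots have no children, so their rank can be chosen freely just above
    that of \<open>x\<close>.\<close>
  have "(if u \<in> adopted N st then Suc (f x) else f u) < (if v \<in> adopted N st then Suc (f x) else f v)"
    if "grown_pa N st pa x v = Some u" for v u
    using that f[of v u] x_not_adopted adopted_root[of u v]
    by (auto simp: grown_pa_def split: if_splits)
  then show "\<exists>f :: nat \<Rightarrow> nat. \<forall>v u. grown_pa N st pa x v = Some u \<longrightarrow> f u < f v"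
    by (intro exI[of _ "\<lambda>v. if v \<in> adopted N st then Suc (f x) else f v"]) blast
qed

interpretation G: forest n src "grown_st N st pa x" "grown_pa N st pa x"
  by (rule forest_grown)

lemma asum_grown_other: "v \<notin> adopted N st \<Longrightarrow> asum (grown_pa N st pa x) f v = asum pa f v"
proof (induction v rule: ancestor_induct)
  case (step v)
  show ?case
  proof (cases "pa v")
    case None
    then show ?thesis using step.prems by (simp add: G.asum_None asum_None grown_pa_other)
  next
    case (Some u)
    then have "u \<notin> adopted N st" using adopted_root by blast
    then show ?thesis using Some step G.asum_Some[of v u] by (simp add: asum_Some grown_pa_other)
  qed
qed

lemma asum_grown_adopted: "v \<in> adopted N st \<Longrightarrow> asum (grown_pa N st pa x) f v = f v + asum pa f x"
  using G.asum_Some[of v x f] asum_grown_other[OF x_not_adopted] by (simp add: grown_pa_adopted)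

lemma unstable_grown_other:
  "v \<notin> adopted N st \<Longrightarrow> unstable (grown_st N st pa x) (grown_pa N st pa x) v \<longleftrightarrow> unstable st pa v"
proof (induction v rule: ancestor_induct)
  case (step v)
  show ?case
  proof (cases "pa v")
    case None
    then have "grown_st N st pa x v = Pruning \<longleftrightarrow> st v = Pruning"
      using step.prems by (simp add: grown_st_def)
    with None show ?thesis using step.prems
      G.unstable_None[of v] unstable_None[of v] by (simp add: grown_pa_other)
  next
    case (Some u)
    then have "u \<notin> adopted N st" using adopted_root by blast
    then show ?thesis using Some step G.unstable_Some[of v u] unstable_Some[of v u]
      by (simp add: grown_pa_other)
  qed
qed

lemma unstable_grown_adopted:
  "v \<in> adopted N st \<Longrightarrow> unstable (grown_st N st pa x) (grown_pa N st pa x) v \<longleftrightarrow> unstable st pa x"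
  using G.unstable_Some[of v x] unstable_grown_other[OF x_not_adopted] by (simp add: grown_pa_adopted)

text \<open>Otherwise \<open>x\<close> has state \<open>Source\<close>, hence is a root that is not
  pruning.\<close>

lemma unstable_growing: "unstable st pa x \<Longrightarrow> st x = Growing"
  using x unstable_None[of x] root_iff[of x] by auto

text \<open>An asking child of \<open>x\<close> starts growing at the moment when \<open>x\<close>
  stops, so below it the count balances. The extra \<open>of_bool (v = x)\<close> records the loss
  at \<open>x\<close> itself, from which the induction pays for such a child.\<close>

lemma growers_grown_other:
  assumes "v \<notin> adopted N st" "unstable st pa v"
  shows "growers (grown_st N st pa x) (grown_pa N st pa x) v + of_bool (v = x) \<le> growers st pa v"
  unfolding asum_grown_other[OF assms(1)]
  using assms
proof (induction v rule: ancestor_induct)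
  case (step v)
  show ?case
  proof (cases "pa v")
    case None
    then show ?thesis
      using step.prems x unstable_None[of v] by (auto simp: asum_None grown_st_def)
  next
    case (Some u)
    then have "u \<notin> adopted N st" "unstable st pa u"
      using adopted_root step.prems unstable_Some by blast+
    note IH = step.IH[OF Some this]
    have "st x = Growing" if "v = x"
      using that unstable_growing step.prems by simp
    moreover have "u \<noteq> v" using no_self_parent[of v] Some by auto
    ultimately show ?thesis
      using IH step.prems unfolding asum_Some[OF Some]
      by (cases "u = x"; cases "v = x"; cases "st v") (simp_all add: grown_st_def Some)
  qed
qed

lemma growers_grown_adopted:
  assumes "v \<in> adopted N st" "unstable st pa x"
  shows "growers (grown_st N st pa x) (grown_pa N st pa x) v < growers st pa x"
proof -
  have "growers (grown_st N st pa x) (grown_pa N st pa x) v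
      = growers (grown_st N st pa x) (grown_pa N st pa x) x"
    using assms(1) asum_grown_adopted[OF assms(1)] asum_grown_other[OF x_not_adopted]
    by (simp add: grown_st_def)
  then show ?thesis using growers_grown_other[OF x_not_adopted assms(2)] by simp
qed

lemma unrest_grown: "unrest n (grown_st N st pa x) (grown_pa N st pa x) \<le> unrest n st pa"
proof -
  define F where "F v = (if unstable st pa v then n ^ growers st pa v else 0)" for v
  define F' where "F' v = (if unstable (grown_st N st pa x) (grown_pa N st pa x) v
    then n ^ growers (grown_st N st pa x) (grown_pa N st pa x) v else 0)" for v
  have n: "1 \<le> n" using x by simp
  have other: "F' v \<le> F v" if "v \<notin> adopted N st" for v
    unfolding F_def F'_def
    using growers_grown_other[OF that] unstable_grown_other[OF that] n by (auto intro!: power_increasing)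
  have "sum F' (insert x (adopted N st)) \<le> sum F (insert x (adopted N st))"
  proof (cases "unstable st pa x")
    case False
    then have "F' v = 0" if "v \<in> insert x (adopted N st)" for v
      using that unstable_grown_adopted unstable_grown_other[OF x_not_adopted] by (auto simp: F'_def)
    then show ?thesis by simp
  next
    case True
    have less: "growers (grown_st N st pa x) (grown_pa N st pa x) v < growers st pa x"
      if "v \<in> insert x (adopted N st)" for v
      using that growers_grown_adopted True growers_grown_other[OF x_not_adopted True] by auto
    \<comment> \<open>\<open>x\<close> itself is growing, so the exponent below is a genuine
      predecessor. The at most n amoebots in question then weigh no more together than
      \<open>x\<close> did before.\<close>
    then have pos: "0 < growers st pa x" by force
    have "sum F' (insert x (adopted N st))
        \<le> (\<Sum>v\<in>insert x (adopted N st). n ^ (growers st pa x - 1))"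
      by (rule sum_mono) (use less n in \<open>fastforce simp: F'_def intro!: power_increasing\<close>)
    also have "\<dots> = card (insert x (adopted N st)) * n ^ (growers st pa x - 1)" by simp
    also have "\<dots> \<le> card {..<n} * n ^ (growers st pa x - 1)"
      by (intro mult_right_mono card_mono) (use x N in \<open>auto simp: adopted_def\<close>)
    also have "\<dots> = F x"
      using pos True by (simp add: F_def power_eq_if)
    also have "\<dots> \<le> sum F (insert x (adopted N st))"
      by (rule member_le_sum) (auto simp: finite_adopted)
    finally show ?thesis .
  qed
  moreover have "sum F' ({..<n} - insert x (adopted N st)) \<le> sum F ({..<n} - insert x (adopted N st))"
    by (rule sum_mono) (simp add: other)
  moreover have "insert x (adopted N st) \<subseteq> {..<n}" using x N by (auto simp: adopted_def)
  ultimately have "sum F' {..<n} \<le> sum F {..<n}"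
    by (simp add: sum.subset_diff[of "insert x (adopted N st)" "{..<n}"])
  then show ?thesis by (simp add: unrest_def F_def F'_def)
qed

lemma level_grown:
  assumes "level n st pa Q K"
  shows "level n (grown_st N st pa x) (grown_pa N st pa x) Q K"
  unfolding level_def
proof (intro conjI ballI allI impI)
  have Q: "\<And>q. q \<in> Q \<Longrightarrow> st q = Pruning" using assms by (simp add: level_def)
  show "grown_st N st pa x q = Pruning" if "q \<in> Q" for q
    using Q[OF that] x by (auto simp: grown_st_def adopted_def)
  fix v assume v: "v < n" "unstable (grown_st N st pa x) (grown_pa N st pa x) v"
  show "dep (grown_pa N st pa x) v + growers (grown_st N st pa x) (grown_pa N st pa x) v
    \<le> K + asum (grown_pa N st pa x) (\<lambda>u. of_bool (u \<in> Q)) v"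
  proof (cases "v \<in> adopted N st")
    case True
    then have "unstable st pa x" using v unstable_grown_adopted by blast
    moreover from this have "dep pa x + growers st pa x \<le> K + asum pa (\<lambda>u. of_bool (u \<in> Q)) x"
      using assms x by (simp add: level_def)
    moreover have "v \<notin> Q" using True Q by (auto simp: adopted_def)
    ultimately show ?thesis
      using growers_grown_adopted[OF True] asum_grown_adopted[OF True, of "\<lambda>_. 1"]
        asum_grown_adopted[OF True, of "\<lambda>u. of_bool (u \<in> Q)"] by simp
  next
    case False
    then have "unstable st pa v" using v unstable_grown_other by blast
    moreover from this have "dep pa v + growers st pa v \<le> K + asum pa (\<lambda>u. of_bool (u \<in> Q)) v"
      using assms v by (simp add: level_def)
    ultimately show ?thesis
      using growers_grown_other[OF False] asum_grown_other[OF False, of "\<lambda>_. 1"]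
        asum_grown_other[OF False, of "\<lambda>u. of_bool (u \<in> Q)"] by simp
  qed
qed

text \<open>Adoption moves isolated roots from depth 1 to a place below \<open>x\<close>; whatever
  energy they still hold counts more there.\<close>

lemma stored_grown: "stored n pa eb \<le> stored n (grown_pa N st pa x) eb"
  unfolding stored_def
proof (intro sum_mono mult_left_mono)
  fix v
  show "dep pa v \<le> dep (grown_pa N st pa x) v"
    using adopted_root[of v] asum_grown_adopted[of v "\<lambda>_. 1"] asum_grown_other[of v "\<lambda>_. 1"]
    by (cases "v \<in> adopted N st") (auto simp: asum_None)
qed simp

text \<open>Since \<open>N\<close> is the whole neighborhood, \<open>x\<close> is left without idle
  neighbors and without asking children, so all its calls vanish. Each adopted amoebot may originate
  one call, paid for by its reserve as an idle amoebot. Strictness comes from \<open>phase\<close>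
  if \<open>x\<close> was growing, and otherwise from the calls that the source \<open>x\<close> had
  by the second assumption.\<close>

lemma work_grown:
  assumes "N = nb x" "st x = Source \<Longrightarrow> adopted N st \<noteq> {} \<or> (\<exists>b. pa b = Some x \<and> st b = Asking)"
  shows "work n nb (grown_st N st pa x) (grown_pa N st pa x) < work n nb st pa"
proof -
  let ?st = "grown_st N st pa x" and ?pa = "grown_pa N st pa x" and ?I = "adopted N st"
  have I_n: "?I \<subseteq> {..<n}" using N by (auto simp: adopted_def)
  have shrink: "adopted M ?st \<subseteq> adopted M st" for M
    using x by (auto simp: adopted_def grown_st_def split: if_splits)
  have asking: "{b. ?pa b = Some y \<and> ?st b = Asking} \<subseteq> {b. pa b = Some y \<and> st b = Asking}" for y
    using x by (auto simp: grown_pa_def grown_st_def split: if_splits)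
  have mono: "calls nb ?st ?pa y \<le> calls nb st pa y" if "y \<notin> ?I" "y \<noteq> x" for y
  proof -
    have "?st y \<in> {Active, Source} \<Longrightarrow> st y \<in> {Active, Source}"
      using that by (auto simp: grown_st_def split: if_splits)
    moreover have "card {b. ?pa b = Some y \<and> ?st b = Asking} \<le> card {b. pa b = Some y \<and> st b = Asking}"
      using asking finite_children by (intro card_mono) auto
    ultimately show ?thesis using shrink[of "nb y"]
      by (auto simp: calls_def)
  qed
  have x0: "calls nb ?st ?pa x = 0"
  proof -
    have "adopted (nb x) ?st = {}"
      using assms(1) x by (auto simp: adopted_def grown_st_def split: if_splits)
    moreover have "{b. ?pa b = Some x \<and> ?st b = Asking} = {}"
      using x by (auto simp: grown_pa_def grown_st_def split: if_splits)
    ultimately show ?thesis by (simp only: calls_def) simp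
  qed
  have I1: "calls nb ?st ?pa y \<le> 1" if "y \<in> ?I" for y
  proof -
    have "{b. pa b = Some y \<and> st b = Asking} = {}" using adopted_root that by blast
    then have "{b. ?pa b = Some y \<and> ?st b = Asking} = {}" using asking by blast
    then show ?thesis by (simp only: calls_def) simp
  qed
  \<comment> \<open>The old contribution of \<open>x\<close> stays on the left, as strictness for a
    source rests on it; \<open>n\<close> is the budget for the one call of an adopted
    amoebot.\<close>
  have pointwise: "calls nb ?st ?pa y * dep ?pa y + (if y = x then calls nb st pa x * dep pa x else 0)
      \<le> calls nb st pa y * dep pa y + (if y \<in> ?I then n else 0)" if "y < n" for y
  proof -
    consider "y = x" | "y \<in> ?I" "y \<noteq> x" | "y \<notin> ?I" "y \<noteq> x" by blast
    then show ?thesis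
    proof cases
      case 2
      have "calls nb ?st ?pa y * dep ?pa y \<le> 1 * n"
        by (intro mult_le_mono I1 G.asum_le) (use 2 that in auto)
      with 2 show ?thesis by simp
    next
      case 3
      have "calls nb ?st ?pa y * dep ?pa y \<le> calls nb st pa y * dep pa y"
        using mono[OF 3] asum_grown_other[OF 3(1)] by simp
      with 3 show ?thesis by simp
    qed (simp add: x0)
  qed
  have A: "(\<Sum>y<n. calls nb ?st ?pa y * dep ?pa y) + calls nb st pa x * dep pa x
      \<le> (\<Sum>y<n. calls nb st pa y * dep pa y) + n * card ?I"
  proof -
    have "(\<Sum>y<n. calls nb ?st ?pa y * dep ?pa y + (if y = x then calls nb st pa x * dep pa x else 0))
      \<le> (\<Sum>y<n. calls nb st pa y * dep pa y + (if y \<in> ?I then n else 0))"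
      by (rule sum_mono) (use pointwise in auto)
    moreover have "(\<Sum>y<n. (if y \<in> ?I then n else 0)) = n * card ?I"
      using I_n by (simp add: sum.If_cases Int_absorb1 inf.absorb2)
    ultimately show ?thesis using x by (simp add: sum.distrib)
  qed
  have B: "(\<Sum>y<n. phase (?st y)) + of_bool (st x = Growing) \<le> (\<Sum>y<n. phase (st y))"
  proof -
    have "(\<Sum>y<n. phase (?st y) + (if y = x then of_bool (st x = Growing) else 0))
        \<le> (\<Sum>y<n. phase (st y))"
      by (rule sum_mono) (use x in \<open>auto simp: grown_st_def adopted_def phase_def\<close>)
    then show ?thesis using x by (simp add: sum.distrib)
  qed
  have C: "card {y. y < n \<and> ?st y = Idle} + card ?I = card {y. y < n \<and> st y = Idle}"
  proof -
    have "{y. y < n \<and> ?st y = Idle} = {y. y < n \<and> st y = Idle} - ?I"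
      by (auto simp: grown_st_def split: if_splits)
    moreover have "?I \<subseteq> {y. y < n \<and> st y = Idle}" using I_n by (auto simp: adopted_def)
    ultimately show ?thesis using finite_adopted
      by (simp add: card_Diff_subset card_mono)
  qed
  have strict: "0 < calls nb st pa x * dep pa x" if "st x \<noteq> Growing"
  proof -
    have src: "st x = Source" using that x by simp
    have "\<exists>b. pa b = Some x \<and> st b = Asking" if "adopted N st = {}" using assms(2) src that by blast
    then have "0 < calls nb st pa x"
      using src assms(1) finite_children by (auto simp: calls_def card_gt_0_iff)
    then show ?thesis using dep_pos by simp
  qed
  have "n * card {y. y < n \<and> ?st y = Idle} + n * card ?I = n * card {y. y < n \<and> st y = Idle}"
    unfolding C[symmetric] by (simp add: algebra_simps)
  moreover have "1 \<le> of_bool (st x = Growing) + calls nb st pa x * dep pa x"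
    using strict by (cases "st x = Growing") (simp_all add: Suc_le_eq del: nat_0_less_mult_iff)
  ultimately show ?thesis
    using A B unfolding work_def by linarith
qed

end

section \<open>Asking for growth\<close>

context
  fixes x :: nat
  assumes x: "x < n" "st x = Active"
begin

lemma forest_ask: "forest n src (st(x := Asking)) pa"
proof
  show "\<exists>f :: nat \<Rightarrow> nat. \<forall>v u. pa v = Some u \<longrightarrow> f u < f v" by (rule ranked)
qed (use source_state nonsource_state root_iff parent x in \<open>fastforce split: if_splits\<close>)+

lemma growers_ask: "growers (st(x := Asking)) pa = growers st pa"
  using x by (intro ext) (auto simp: asum_def intro: sum.cong)

lemma unstable_ask: "unstable (st(x := Asking)) pa = unstable st pa"
proof -
  have "(st(x := Asking)) u = Pruning \<longleftrightarrow> st u = Pruning" for u using x by simp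
  then show ?thesis by (intro ext) (simp only: unstable_def)
qed

lemma unrest_ask: "unrest n (st(x := Asking)) pa = unrest n st pa"
  by (simp only: unrest_def growers_ask unstable_ask)

lemma level_ask: "level n st pa Q K \<Longrightarrow> level n (st(x := Asking)) pa Q K"
  using x unfolding level_def growers_ask unstable_ask by auto

text \<open>At least one call is deleted at \<open>x\<close>, and at most one appears at its parent,
  one level higher. This saves 3, while \<open>phase\<close> rises by 2.\<close>

lemma work_ask:
  assumes "adopted (nb x) st \<noteq> {} \<or> (\<exists>b. pa b = Some x \<and> st b = Asking)"
  shows "work n nb (st(x := Asking)) pa < work n nb st pa"
proof -
  let ?st = "st(x := Asking)"
  obtain p where p: "pa x = Some p" "p < n" "p \<noteq> x"
    using root_iff[of x] parent[of x] no_self_parent x by (cases "pa x") auto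
  have adopt: "adopted M ?st = adopted M st" for M
    using x by (auto simp: adopted_def)
  have child: "{b. pa b = Some y \<and> ?st b = Asking} =
      (if y = p then insert x {b. pa b = Some y \<and> st b = Asking}
       else {b. pa b = Some y \<and> st b = Asking})" for y
    using p by auto
  have "0 < calls nb st pa x"
    using assms x finite_children by (auto simp: calls_def card_gt_0_iff)
  then have own: "dep pa x \<le> calls nb st pa x * dep pa x" by simp
  have pointwise: "calls nb ?st pa y * dep pa y + (if y = x then dep pa x else 0)
      \<le> calls nb st pa y * dep pa y + (if y = p then dep pa p else 0)" for y
  proof (cases "y = x")
    case True
    then show ?thesis using own by (simp add: calls_def)
  next
    case False
    have "card {b. pa b = Some y \<and> ?st b = Asking}
        \<le> card {b. pa b = Some y \<and> st b = Asking} + of_bool (y = p)"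
      unfolding child by (simp add: card_insert_if finite_children)
    then have "calls nb ?st pa y \<le> calls nb st pa y + of_bool (y = p)"
      using False unfolding calls_def adopt by simp
    then have "calls nb ?st pa y * dep pa y \<le> (calls nb st pa y + of_bool (y = p)) * dep pa y"
      by (rule mult_right_mono) simp
    with False show ?thesis by (cases "y = p") (simp_all add: algebra_simps)
  qed
  have "(\<Sum>y<n. calls nb ?st pa y * dep pa y + (if y = x then dep pa x else 0))
      \<le> (\<Sum>y<n. calls nb st pa y * dep pa y + (if y = p then dep pa p else 0))"
    by (rule sum_mono) (rule pointwise)
  then have A: "(\<Sum>y<n. calls nb ?st pa y * dep pa y) + dep pa x
      \<le> (\<Sum>y<n. calls nb st pa y * dep pa y) + dep pa p"
    using x p by (simp add: sum.distrib)
  have "(\<Sum>y<n. phase (?st y)) \<le> (\<Sum>y<n. phase (st y) + (if y = x then 2 else 0))"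
    by (rule sum_mono) (simp add: phase_def)
  then have B: "(\<Sum>y<n. phase (?st y)) \<le> (\<Sum>y<n. phase (st y)) + 2"
    using x by (simp add: sum.distrib)
  have C: "{y. y < n \<and> ?st y = Idle} = {y. y < n \<and> st y = Idle}"
    using x by auto
  show ?thesis
    using A B asum_Some[OF p(1), of "\<lambda>_. 1"] unfolding work_def C by simp
qed

end

section \<open>Energy transport\<close>

lemma stored_harvest:
  assumes "x < n"
  shows "stored n pa eb < stored n pa (eb(x := eb x + 1))"
  unfolding stored_def
  by (rule sum_strict_mono_ex1) (use assms dep_pos in auto)

lemma stored_share:
  assumes "pa b = Some x" "1 \<le> eb x"
  shows "stored n pa eb < stored n pa (eb(x := eb x - 1, b := eb b + 1))"
proof -
  have b: "b < n" "x < n" "b \<noteq> x" using parent no_self_parent assms by (metis)+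
  obtain m where m: "eb x = Suc m" using assms(2) by (cases "eb x") auto
  \<comment> \<open>To avoid subtraction, the unit taken from \<open>x\<close> is added back on the
    right and the unit given to \<open>b\<close> on the left.\<close>
  have "(\<Sum>v<n. eb v * dep pa v + (if v = b then dep pa b else 0))
      = (\<Sum>v<n. (eb(x := eb x - 1, b := eb b + 1)) v * dep pa v + (if v = x then dep pa x else 0))"
    by (rule sum.cong) (use b m in \<open>auto simp: algebra_simps\<close>)
  then have "stored n pa eb + dep pa b = stored n pa (eb(x := eb x - 1, b := eb b + 1)) + dep pa x"
    using b by (simp add: stored_def sum.distrib)
  then show ?thesis using asum_Some[OF assms(1), of "\<lambda>_. 1"] by simp
qed

end

section \<open>Ports and neighbors\<close>

declare split_paired_Ex [simp del] split_paired_All [simp del]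

lemma dir_vec_nonzero: "dir_vec d \<noteq> 0"
  by (simp add: dir_vec_def zero_prod_def)

lemma dir_vec_uminus: "\<exists>d'. dir_vec d' = - dir_vec d"
proof -
  have "\<exists>d'. dir_vec d' = w" if "w \<in> {(1, 0), (0, 1), (-1, 1), (-1, 0), (0, -1), (1, -1)}" for w
  proof -
    have "dir_vec 0 = (1, 0)" "dir_vec 1 = (0, 1)" "dir_vec 2 = (-1, 1)" "dir_vec 3 = (-1, 0)"
      "dir_vec 4 = (0, -1)" "dir_vec 5 = (1, -1)"
      by (simp_all add: dir_vec_def)
    with that show ?thesis by blast
  qed
  moreover have "- dir_vec d \<in> {(1, 0), (0, 1), (-1, 1), (-1, 0), (0, -1), (1, -1)}"
    by (simp add: dir_vec_def)
  ultimately show ?thesis by blast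
qed

lemma adjacent_sym: "adjacent u v \<Longrightarrow> adjacent v u"
proof -
  assume "adjacent u v"
  then obtain d where "v = u + dir_vec d" by (auto simp: adjacent_def)
  moreover obtain d' where "dir_vec d' = - dir_vec d" using dir_vec_uminus by blast
  ultimately show "adjacent v u" by (auto simp: adjacent_def intro!: exI[of _ d'])
qed

lemma adjacent_irrefl: "\<not> adjacent u u"
  using dir_vec_nonzero by (auto simp: adjacent_def)

lemma global_dir_surj: "\<exists>e. global_dir ori e = d"
proof (cases "snd ori")
  case True
  then show ?thesis by (intro exI[of _ "d - fst ori"]) (simp add: global_dir_def)
next
  case False
  then show ?thesis by (intro exI[of _ "fst ori - d"]) (simp add: global_dir_def)
qed

lemma port_target_adjacent:
  assumes "port_target c a p = Some v"
  shows "v \<notin> nodes (body c a)" "\<exists>u\<in>nodes (body c a). adjacent u v"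
  using assms dir_vec_nonzero
  by (cases p rule: prod.exhaust; cases "fst p"; cases "body c a";
      auto simp: port_target_def adjacent_def Let_def split: if_splits)+

lemma legal_unique:
  "legal c \<Longrightarrow> a < num c \<Longrightarrow> b < num c \<Longrightarrow> v \<in> nodes (body c a) \<Longrightarrow> v \<in> nodes (body c b) \<Longrightarrow> a = b"
  unfolding legal_def by blast

text \<open>Legality makes the occupant of a node unique, so the definite description in
  \<open>neighbor_at\<close> is well defined.\<close>

lemma neighbor_at_iff:
  assumes "legal c"
  shows "neighbor_at c a p = Some b \<longleftrightarrow>
    (\<exists>v. port_target c a p = Some v \<and> b < num c \<and> v \<in> nodes (body c b))"
proof (cases "port_target c a p")
  case (Some v)
  have "(THE b. b < num c \<and> v \<in> nodes (body c b)) = b" if "b < num c" "v \<in> nodes (body c b)" for b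
    using that legal_unique[OF assms] by (intro the_equality) blast+
  then show ?thesis using Some by (auto simp: neighbor_at_def occupied_def)
qed (simp add: neighbor_at_def)

lemma neighbors_sym: "a < num c \<Longrightarrow> b \<in> neighbors c a \<Longrightarrow> a \<in> neighbors c b"
  using adjacent_sym by (fastforce simp: neighbors_def)

lemma neighbor_at_neighbors:
  assumes "legal c" "neighbor_at c a p = Some b"
  shows "b \<in> neighbors c a"
proof -
  obtain v where v: "port_target c a p = Some v" "b < num c" "v \<in> nodes (body c b)"
    using assms by (auto simp: neighbor_at_iff)
  with port_target_adjacent[OF v(1)] show ?thesis by (auto simp: neighbors_def)
qed

text \<open>An orientation reaches every direction, and the node of another amoebot is never an own
  node, so the connecting edge carries a port. This supplies the parent ports of adopted
  amoebots.\<close>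

lemma neighbors_port:
  assumes "legal c" "b < num c" "a \<in> neighbors c b"
  shows "\<exists>p. neighbor_at c b p = Some a"
proof -
  obtain u v where uv: "v \<in> nodes (body c b)" "u \<in> nodes (body c a)" "adjacent v u" and a: "a < num c" "a \<noteq> b"
    using assms(3) by (auto simp: neighbors_def)
  obtain d where d: "u = v + dir_vec d" using uv by (auto simp: adjacent_def)
  obtain e where e: "global_dir (orient c b) e = d" using global_dir_surj by blast
  have "u \<notin> nodes (body c b)" using legal_unique[OF assms(1) a(1) assms(2) uv(2)] a by blast
  then have "port_target c b (Tail, e) = Some u \<or> port_target c b (Head, e) = Some u"
    using uv(1) d e by (cases "body c b") (auto simp: port_target_def Let_def)
  then show ?thesis using assms(1) uv a by (auto simp: neighbor_at_iff)
qed

lemma mem_update_simps [simp]: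
  "port_target (c\<lparr>mem := m\<rparr>) = port_target c" "neighbor_at (c\<lparr>mem := m\<rparr>) = neighbor_at c"
  "neighbors (c\<lparr>mem := m\<rparr>) = neighbors c" "legal (c\<lparr>mem := m\<rparr>) = legal c"
  by (auto simp: fun_eq_iff port_target_def neighbor_at_def occupied_def neighbors_def legal_def
      split: option.split)

lemma erase_simps [simp]:
  "num (erase c) = num c" "orient (erase c) = orient c" "body (erase c) = body c"
  "mem (erase c) a = base (mem c a)"
  "port_target (erase c) = port_target c" "neighbor_at (erase c) = neighbor_at c"
  "neighbors (erase c) = neighbors c" "legal (erase c) = legal c"
  by (auto simp: fun_eq_iff erase_def port_target_def neighbor_at_def occupied_def neighbors_def
      legal_def split: option.split)

lemma erase_eqD:
  assumes "erase c' = erase c"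
  shows "num c' = num c" "body c' = body c" "neighbors c' = neighbors c" "legal c' = legal c"
  using assms erase_simps by metis+

section \<open>The forest of a configuration\<close>

text \<open>Memories beyond \<open>num c\<close> are arbitrary and must not contribute
  edges.\<close>

definition par :: "'m emem config \<Rightarrow> nat \<Rightarrow> nat option" where
  "par c a = (if a < num c then Option.bind (parent (mem c a)) (neighbor_at c a) else None)"

abbreviation states :: "'m emem config \<Rightarrow> nat \<Rightarrow> estate" where
  "states c \<equiv> \<lambda>a. state (mem c a)"

abbreviation sources :: "'m emem config \<Rightarrow> nat \<Rightarrow> bool" where
  "sources c \<equiv> \<lambda>a. is_source (mem c a)"

abbreviation charge :: "'m emem config \<Rightarrow> nat \<Rightarrow> nat" where
  "charge c \<equiv> \<lambda>a. ebat (mem c a)"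

text \<open>The condition on \<open>parent\<close> excludes dangling ports. A port leading to an
  empty node is invisible in \<open>par\<close>, but a later movement into that node would create an
  edge.\<close>

definition sound :: "nat \<Rightarrow> 'm emem config \<Rightarrow> bool" where
  "sound \<kappa> c \<longleftrightarrow> legal c \<and> forest (num c) (sources c) (states c) (par c) \<and>
    (\<forall>a<num c. parent (mem c a) = None \<or> par c a \<noteq> None) \<and>
    (\<forall>a<num c. ebat (mem c a) \<le> \<kappa>) \<and> (\<exists>a<num c. is_source (mem c a))"

lemma children_eq: "legal c \<Longrightarrow> children c a = {b. par c b = Some a}"
proof (intro set_eqI)
  fix b
  assume c: "legal c"
  have "b \<in> neighbors c a" if "b < num c" "neighbor_at c b p = Some a" for p
    using that(1) neighbor_at_neighbors[OF c that(2)] by (rule neighbors_sym)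
  moreover have "b < num c" if "b \<in> neighbors c a"
    using that by (simp add: neighbors_def)
  ultimately show "b \<in> children c a \<longleftrightarrow> b \<in> {b. par c b = Some a}"
    unfolding children_def par_def by (cases "parent (mem c b)") auto
qed

lemma soundI:
  assumes "legal c" "forest (num c) (sources c) (states c) (par c)"
    and "\<And>a. a < num c \<Longrightarrow> parent (mem c a) = None \<or> par c a \<noteq> None"
    and "\<And>a. a < num c \<Longrightarrow> ebat (mem c a) \<le> \<kappa>"
    and "\<exists>a<num c. is_source (mem c a)"
  shows "sound \<kappa> c"
  unfolding sound_def using assms by simp

lemma soundD:
  assumes "sound \<kappa> c"
  shows "legal c" "forest (num c) (sources c) (states c) (par c)"
    and "a < num c \<Longrightarrow> parent (mem c a) = None \<or> par c a \<noteq> None"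
    and "a < num c \<Longrightarrow> ebat (mem c a) \<le> \<kappa>"
    and "\<exists>a<num c. is_source (mem c a)"
  using assms unfolding sound_def by simp_all

lemma sound_root:
  assumes "sound \<kappa> c" "a < num c" "state (mem c a) \<in> {Source, Idle, Pruning}"
  shows "parent (mem c a) = None" "par c a = None"
  using assms forest.root_iff unfolding sound_def by metis+

text \<open>In sound configurations the subtraction does not truncate, by
  \<open>stored_le\<close>.\<close>

definition potential :: "nat \<Rightarrow> 'm emem config \<Rightarrow> nat" where
  "potential \<kappa> c = work (num c) (neighbors c) (states c) (par c)
    + (\<kappa> * (num c)\<^sup>2 - stored (num c) (par c) (charge c))"

abbreviation unrest_of :: "'m emem config \<Rightarrow> nat" where
  "unrest_of c \<equiv> unrest (num c) (states c) (par c)"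

abbreviation level_of :: "'m emem config \<Rightarrow> nat set \<Rightarrow> nat \<Rightarrow> bool" where
  "level_of c \<equiv> level (num c) (states c) (par c)"

text \<open>\<open>Q - {a}\<close>: a pruning root that acts is no longer awaited. The relation is transitive because the
  blocks of one action are all executed by the same amoebot.\<close>

definition settles :: "nat \<Rightarrow> nat \<Rightarrow> 'm emem config \<Rightarrow> 'm emem config \<Rightarrow> bool" where
  "settles \<kappa> a c c' \<longleftrightarrow> sound \<kappa> c' \<and> erase c' = erase c \<and>
    (unrest_of c' < unrest_of c \<or> unrest_of c' = unrest_of c \<and> potential \<kappa> c' < potential \<kappa> c) \<and>
    (\<forall>Q K. level_of c Q K \<longrightarrow> level_of c' (Q - {a}) K)"

lemma settles_trans:
  assumes "settles \<kappa> a c c'" "settles \<kappa> a c' c''"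
  shows "settles \<kappa> a c c''"
  unfolding settles_def
proof (intro conjI allI impI)
  fix Q K assume "level_of c Q K"
  then have "level_of c'' (Q - {a} - {a}) K" using assms unfolding settles_def by presburger
  then show "level_of c'' (Q - {a}) K" by simp
next
  show "unrest_of c'' < unrest_of c \<or>
      unrest_of c'' = unrest_of c \<and> potential \<kappa> c'' < potential \<kappa> c"
    using assms unfolding settles_def by linarith
qed (use assms in \<open>simp_all add: settles_def\<close>)

lemma potential_le: "sound \<kappa> c \<Longrightarrow> potential \<kappa> c \<le> (11 + \<kappa>) * (num c)\<^sup>2"
  using forest.work_le[of "num c" "sources c" "states c" "par c" "neighbors c"]
  by (auto simp: potential_def sound_def algebra_simps)

section \<open>The blocks of the energy distribution action\<close>

lemma prune_simps [simp]:
  "num (prune a c) = num c" "neighbor_at (prune a c) = neighbor_at c"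
  "is_source (mem (prune a c) b) = is_source (mem c b)" "ebat (mem (prune a c) b) = ebat (mem c b)"
  "base (mem (prune a c) b) = base (mem c b)" "erase (prune a c) = erase c"
  "legal (prune a c) = legal c"
  by (auto simp: prune_def erase_def)

lemma states_prune:
  "legal c \<Longrightarrow> states (prune a c) = pruned_st (sources c) (states c) (par c) a"
  by (auto simp: prune_def pruned_st_def children_eq)

lemma parent_prune:
  "legal c \<Longrightarrow> parent (mem (prune a c) b) = (if par c b = Some a then None else parent (mem c b))"
  by (auto simp: prune_def children_eq)

lemma par_prune:
  "legal c \<Longrightarrow> parent (mem c a) = None \<Longrightarrow> par (prune a c) = pruned_pa (par c) a"
  by (rule ext) (auto simp: par_def pruned_pa_def parent_prune)

lemma sound_prune:
  assumes "sound \<kappa> c" "a < num c" "parent (mem c a) = None"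
  shows "sound \<kappa> (prune a c)"
proof -
  have c: "legal c" "forest (num c) (sources c) (states c) (par c)"
    using assms(1) by (rule soundD)+
  note eqs = states_prune[OF c(1)] par_prune[OF c(1) assms(3)]
  show ?thesis
  proof (rule soundI; (unfold prune_simps eqs)?)
    show "parent (mem (prune a c) b) = None \<or> pruned_pa (par c) a b \<noteq> None" if "b < num c" for b
      using soundD(3)[OF assms(1) that] assms(3) by (simp add: parent_prune[OF c(1)] pruned_pa_def)
  qed (use soundD[OF assms(1)] forest.forest_pruned[OF c(2) assms(2)] in simp_all)
qed

lemma settles_prune:
  assumes "sound \<kappa> c" "a < num c" "g_get_pruned c a"
  shows "settles \<kappa> a c (prune a c)"
proof -
  have c: "legal c" and f: "forest (num c) (sources c) (states c) (par c)"
    using assms(1) by (rule soundD)+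
  have p: "parent (mem c a) = None" "state (mem c a) = Pruning"
    using assms sound_root by (auto simp: g_get_pruned_def)
  note eqs = states_prune[OF c] par_prune[OF c p(1)]
  show ?thesis
    unfolding settles_def prune_simps eqs
    using sound_prune[OF assms(1,2) p(1)] forest.unrest_pruned[OF f assms(2)]
      forest.level_pruned[OF f assms(2)] p
    by auto
qed

text \<open>Covers all blocks but pruning. As \<open>Q\<close> contains pruning amoebots only, it
  does not contain \<open>a\<close>, and removing \<open>a\<close> from it changes nothing.\<close>

lemma settlesI:
  assumes "sound \<kappa> c" "sound \<kappa> c'" "erase c' = erase c" "state (mem c a) \<noteq> Pruning"
    and "unrest_of c' \<le> unrest_of c"
    and "work (num c) (neighbors c) (states c') (par c') \<le> work (num c) (neighbors c) (states c) (par c)"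
    and "stored (num c) (par c) (charge c) \<le> stored (num c) (par c') (charge c')"
    and "work (num c) (neighbors c) (states c') (par c') < work (num c) (neighbors c) (states c) (par c)
      \<or> stored (num c) (par c) (charge c) < stored (num c) (par c') (charge c')"
    and "\<And>Q K. level_of c Q K \<Longrightarrow> level_of c' Q K"
  shows "settles \<kappa> a c c'"
proof -
  note [simp] = erase_eqD[OF assms(3)]
  have "stored (num c) (par c') (charge c') \<le> \<kappa> * (num c)\<^sup>2"
    using assms(2) forest.stored_le[of "num c'" "sources c'" "states c'" "par c'" "charge c'"]
    by (auto simp: sound_def)
  then have "potential \<kappa> c' < potential \<kappa> c"
    using assms(6,7,8) by (auto simp: potential_def)
  moreover have "level_of c' (Q - {a}) K" if "level_of c Q K" for Q K
  proof -
    have "a \<notin> Q" using that assms(4) by (auto simp: level_def)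
    then show ?thesis using assms(9)[OF that] by simp
  qed
  ultimately show ?thesis using assms(2,3,5) by (auto simp: settles_def)
qed

lemma par_cong:
  assumes "erase c' = erase c" "\<And>b. parent (mem c' b) = parent (mem c b)"
  shows "par c' = par c"
proof -
  have "neighbor_at c' = neighbor_at c" "num c' = num c"
    using assms(1) erase_simps by metis+
  then show ?thesis using assms(2) by (auto simp: par_def)
qed

lemma erase_update_mem: "(\<And>m. base (f m) = base m) \<Longrightarrow> erase (update_mem a f c) = erase c"
  by (auto simp: erase_def update_mem_def)

lemma settles_ask:
  assumes "sound \<kappa> c" "a < num c" "g_ask_growth c a"
  shows "settles \<kappa> a c (update_mem a (\<lambda>m. m\<lparr>state := Asking\<rparr>) c)" (is "settles _ _ _ ?c")
proof -
  have c: "legal c" and f: "forest (num c) (sources c) (states c) (par c)"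
    using assms(1) by (rule soundD)+
  have a: "state (mem c a) = Active" using assms(3) by (simp add: g_ask_growth_def)
  have e: "erase ?c = erase c" by (rule erase_update_mem) simp
  have p: "par ?c = par c" by (rule par_cong[OF e]) (simp add: update_mem_def)
  have s: "states ?c = (states c)(a := Asking)" by (auto simp: update_mem_def)
  have o: "sources ?c = sources c" "charge ?c = charge c" "num ?c = num c"
    by (auto simp: update_mem_def)
  have so: "sound \<kappa> ?c"
  proof (rule soundI; (unfold p s o)?)
    show "parent (mem ?c b) = None \<or> par c b \<noteq> None" "ebat (mem ?c b) \<le> \<kappa>" if "b < num c" for b
      using soundD(3,4)[OF assms(1) that] by (auto simp: update_mem_def)
    show "\<exists>b<num c. is_source (mem ?c b)"
      using soundD(5)[OF assms(1)] by (auto simp: update_mem_def)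
  qed (use c forest.forest_ask[OF f assms(2) a] in \<open>simp_all add: update_mem_def\<close>)
  have "adopted (neighbors c a) (states c) \<noteq> {} \<or> (\<exists>b. par c b = Some a \<and> state (mem c b) = Asking)"
    using assms(3) c
    by (auto simp: g_ask_growth_def adopted_def idle_neighbors_def asking_children_def children_eq)
  then show ?thesis
    using a forest.unrest_ask[OF f assms(2) a] forest.work_ask[OF f assms(2) a, of "neighbors c"]
      forest.level_ask[OF f assms(2) a]
    by (intro settlesI[OF assms(1) so e]) (simp_all only: p s o, auto)
qed

lemma settles_grow:
  assumes "sound \<kappa> c" "a < num c" "g_grow_forest c a" "grow_forest c a c'"
  shows "settles \<kappa> a c c'"
proof -
  have c: "legal c" and f: "forest (num c) (sources c) (states c) (par c)"
    using assms(1) by (rule soundD)+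
  obtain g where g: "\<And>b. b \<in> idle_neighbors c a \<Longrightarrow> neighbor_at c b (g b) = Some a"
    and c': "c' = c\<lparr>mem := (\<lambda>b.
        if b \<in> idle_neighbors c a then (mem c b)\<lparr>parent := Some (g b), state := Active\<rparr>
        else if b \<in> asking_children c a then (mem c b)\<lparr>state := Growing\<rparr>
        else if b = a \<and> state (mem c a) = Growing then (mem c b)\<lparr>state := Active\<rparr>
        else mem c b)\<rparr>"
    using assms(4) by (auto simp: grow_forest_def)
  have a: "state (mem c a) = Growing \<or> state (mem c a) = Source"
    using assms(3) by (auto simp: g_grow_forest_def)
  have N: "neighbors c a \<subseteq> {..<num c}" "a \<notin> neighbors c a" by (auto simp: neighbors_def)
  have idle: "idle_neighbors c a = adopted (neighbors c a) (states c)"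
    by (auto simp: idle_neighbors_def adopted_def)
  have e: "erase c' = erase c" by (auto simp: c' erase_def)
  have s: "states c' = grown_st (neighbors c a) (states c) (par c) a"
    using c by (auto simp: c' idle[symmetric] grown_st_def asking_children_def children_eq)
  have nat: "neighbor_at c' = neighbor_at c" "num c' = num c" by (simp_all add: c')
  have p: "par c' = grown_pa (neighbors c a) (states c) (par c) a"
  proof
    fix b
    have "b < num c" if "b \<in> idle_neighbors c a" using that by (auto simp: idle_neighbors_def neighbors_def)
    then show "par c' b = grown_pa (neighbors c a) (states c) (par c) a b"
      using g[of b] by (auto simp: par_def nat grown_pa_def idle[symmetric]) (auto simp: c')
  qed
  have o: "sources c' = sources c" "charge c' = charge c" "num c' = num c" "legal c' = legal c"
    by (auto simp: c')
  have raw: "parent (mem c' b) = parent (mem c b)" if "b \<notin> idle_neighbors c a" for b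
    using that by (simp add: c')
  have so: "sound \<kappa> c'"
  proof (rule soundI; (unfold p s o)?)
    show "parent (mem c' b) = None \<or> grown_pa (neighbors c a) (states c) (par c) a b \<noteq> None"
      if "b < num c" for b
      using soundD(3)[OF assms(1) that] raw by (auto simp: grown_pa_def idle[symmetric])
  qed (use soundD[OF assms(1)] forest.forest_grown[OF f assms(2) a N] fun_cong[OF o(1)]
      fun_cong[OF o(2)] in simp_all)
  have "adopted (neighbors c a) (states c) \<noteq> {} \<or> (\<exists>b. par c b = Some a \<and> state (mem c b) = Asking)"
    if "state (mem c a) = Source"
    using assms(3) c that
    by (auto simp: g_grow_forest_def adopted_def idle_neighbors_def asking_children_def children_eq)
  then have w: "work (num c) (neighbors c) (states c') (par c')
      < work (num c) (neighbors c) (states c) (par c)"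
    unfolding s p by (intro forest.work_grown[OF f assms(2) a N]) auto
  show ?thesis
    using a w forest.unrest_grown[OF f assms(2) a N] forest.stored_grown[OF f assms(2) a N]
      forest.level_grown[OF f assms(2) a N]
    by (intro settlesI[OF assms(1) so e]) (simp_all only: p s o, auto)
qed

lemma settles_charge:
  assumes "sound \<kappa> c" "erase c' = erase c" "state (mem c a) \<noteq> Pruning"
    and "\<And>b. parent (mem c' b) = parent (mem c b)" "states c' = states c" "sources c' = sources c"
    and "\<And>b. b < num c \<Longrightarrow> ebat (mem c' b) \<le> \<kappa>"
    and "stored (num c) (par c) (charge c) < stored (num c) (par c) (charge c')"
  shows "settles \<kappa> a c c'"
proof -
  have p: "par c' = par c" by (rule par_cong) (use assms in auto)
  note n = erase_eqD[OF assms(2)]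
  have so: "sound \<kappa> c'"
    using soundD[OF assms(1)] assms(7) fun_cong[OF assms(6)]
    by (intro soundI; (unfold p n assms(4,5,6))?) simp_all
  show ?thesis
    using assms(8) by (intro settlesI[OF assms(1) so assms(2,3)]) (simp_all only: p n assms(5), auto)
qed

lemma settles_harvest:
  assumes "sound \<kappa> c" "a < num c" "g_harvest_energy \<kappa> c a"
  shows "settles \<kappa> a c (update_mem a (\<lambda>m. m\<lparr>ebat := ebat m + 1\<rparr>) c)" (is "settles _ _ _ ?c")
proof (rule settles_charge[OF assms(1)])
  have f: "forest (num c) (sources c) (states c) (par c)"
    using assms(1) by (rule soundD)+
  have "charge ?c = (charge c)(a := charge c a + 1)" by (auto simp: update_mem_def)
  then show "stored (num c) (par c) (charge c) < stored (num c) (par c) (charge ?c)"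
    using forest.stored_harvest[OF f assms(2), of "charge c"] by (simp del: fun_upd_apply)
  show "erase ?c = erase c" by (rule erase_update_mem) simp
qed (use assms in \<open>auto simp: g_harvest_energy_def sound_def update_mem_def\<close>)

lemma settles_share:
  assumes "sound \<kappa> c" "a < num c" "g_share_energy \<kappa> c a" "share_energy \<kappa> c a c'"
  shows "settles \<kappa> a c c'"
proof -
  have c: "legal c" and f: "forest (num c) (sources c) (states c) (par c)"
    using assms(1) by (rule soundD)+
  obtain b where b: "par c b = Some a" "ebat (mem c b) < \<kappa>"
    and c': "c' = update_mem b (\<lambda>m. m\<lparr>ebat := ebat m + 1\<rparr>)
             (update_mem a (\<lambda>m. m\<lparr>ebat := ebat m - 1\<rparr>) c)"
    using assms(4) c by (auto simp: share_energy_def children_eq)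
  have ab: "a \<noteq> b" using forest.no_self_parent[OF f] b by metis
  have ch: "charge c' = (charge c)(a := charge c a - 1, b := charge c b + 1)"
    using ab by (auto simp: c' update_mem_def)
  show ?thesis
  proof (rule settles_charge[OF assms(1)])
    show "erase c' = erase c" unfolding c' by (simp add: erase_update_mem)
    show "stored (num c) (par c) (charge c) < stored (num c) (par c) (charge c')"
      unfolding ch using forest.stored_share[OF f b(1), of "charge c"] assms(3)
      by (simp add: g_share_energy_def del: fun_upd_apply)
    show "ebat (mem c' v) \<le> \<kappa>" if "v < num c" for v
    proof -
      have "ebat (mem c v) \<le> \<kappa>" using assms(1) that by (simp add: sound_def)
      then show ?thesis using b by (auto simp: fun_cong[OF ch])
    qed
  qed (use assms(3) in \<open>auto simp: g_share_energy_def c' update_mem_def\<close>)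
qed

lemma settles_ed:
  assumes "sound \<kappa> c" "a < num c" "ed_guard \<kappa> c a" "ed_exec \<kappa> c a c'"
  shows "settles \<kappa> a c c'"
proof -
  obtain c1 c2 c3 c4 where
    1: "c1 = (if g_get_pruned c a then prune a c else c)" and
    2: "c2 = (if g_ask_growth c1 a then update_mem a (\<lambda>m. m\<lparr>state := Asking\<rparr>) c1 else c1)" and
    3: "if g_grow_forest c2 a then grow_forest c2 a c3 else c3 = c2" and
    4: "c4 = (if g_harvest_energy \<kappa> c3 a then update_mem a (\<lambda>m. m\<lparr>ebat := ebat m + 1\<rparr>) c3
            else c3)" and
    5: "if g_share_energy \<kappa> c4 a then share_energy \<kappa> c4 a c' else c' = c4"
    using assms(4) unfolding ed_exec_def by blast
  have D: "sound \<kappa> d' \<and> a < num d'" if "settles \<kappa> a d d'" "a < num d" for d d' :: "'a emem config"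
    using that erase_eqD(1)[of d' d] by (simp add: settles_def)
  have s1: "if g_get_pruned c a then settles \<kappa> a c c1 else c1 = c"
    using 1 settles_prune assms by auto
  then have i1: "sound \<kappa> c1" "a < num c1" using D[of c c1] assms by (simp_all split: if_splits)
  have s2: "if g_ask_growth c1 a then settles \<kappa> a c1 c2 else c2 = c1"
    using 2 settles_ask i1 by auto
  then have i2: "sound \<kappa> c2" "a < num c2" using D[of c1 c2] i1 by (simp_all split: if_splits)
  have s3: "if g_grow_forest c2 a then settles \<kappa> a c2 c3 else c3 = c2"
    using 3 settles_grow i2 by auto
  then have i3: "sound \<kappa> c3" "a < num c3" using D[of c2 c3] i2 by (simp_all split: if_splits)
  have s4: "if g_harvest_energy \<kappa> c3 a then settles \<kappa> a c3 c4 else c4 = c3"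
    using 4 settles_harvest i3 by auto
  then have i4: "sound \<kappa> c4" "a < num c4" using D[of c3 c4] i3 by (simp_all split: if_splits)
  have s5: "if g_share_energy \<kappa> c4 a then settles \<kappa> a c4 c' else c' = c4"
    using 5 settles_share i4 by auto
  have t: "settles \<kappa> a d d'' \<or> d'' = d"
    if "settles \<kappa> a d d' \<or> d' = d" "settles \<kappa> a d' d'' \<or> d'' = d'" for d d' d'' :: "'a emem config"
    using that settles_trans by blast
  have r4: "settles \<kappa> a c4 c' \<or> c' = c4" using s5 by metis
  have r3: "settles \<kappa> a c3 c' \<or> c' = c3" using s4 by (intro t[OF _ r4]) metis
  have r2: "settles \<kappa> a c2 c' \<or> c' = c2" using s3 by (intro t[OF _ r3]) metis
  have r1: "settles \<kappa> a c1 c' \<or> c' = c1" using s2 by (intro t[OF _ r2]) metis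
  \<comment> \<open>The guard is tested in \<open>c\<close>, the blocks in later configurations. But
    as long as no block has fired the configuration is still \<open>c\<close>, so the predicate that
    made the guard true is still true when its block is reached: some block fires.\<close>
  consider "settles \<kappa> a c c1" | "settles \<kappa> a c c2" | "settles \<kappa> a c c3" | "settles \<kappa> a c c4"
    | "settles \<kappa> a c c'"
    using assms(3) s1 s2 s3 s4 s5 unfolding ed_guard_def by metis
  then show ?thesis
    using r1 r2 r3 r4 by cases (use settles_trans in blast)+
qed

lemma grow_forest_exists:
  assumes "legal c" "a < num c"
  shows "\<exists>c'. grow_forest c a c'"
proof -
  have "\<exists>p. neighbor_at c b p = Some a" if "b \<in> idle_neighbors c a" for b
    using that assms neighbors_sym[of a c b] neighbors_port[of c b a]
    by (auto simp: idle_neighbors_def neighbors_def)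
  then obtain f where "\<forall>b\<in>idle_neighbors c a. neighbor_at c b (f b) = Some a" by metis
  then show ?thesis unfolding grow_forest_def by blast
qed

lemma ed_exec_exists:
  assumes "legal c" "a < num c"
  shows "\<exists>c'. ed_exec \<kappa> c a c'"
proof -
  define c1 where "c1 = (if g_get_pruned c a then prune a c else c)"
  define c2 where "c2 = (if g_ask_growth c1 a then update_mem a (\<lambda>m. m\<lparr>state := Asking\<rparr>) c1 else c1)"
  have "legal c2" "a < num c2" using assms by (auto simp: c1_def c2_def update_mem_def)
  then obtain c3 where c3: "if g_grow_forest c2 a then grow_forest c2 a c3 else c3 = c2"
    using grow_forest_exists by metis
  define c4 where "c4 = (if g_harvest_energy \<kappa> c3 a
    then update_mem a (\<lambda>m. m\<lparr>ebat := ebat m + 1\<rparr>) c3 else c3)"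
  have "\<exists>c5. share_energy \<kappa> c4 a c5" if "g_share_energy \<kappa> c4 a"
    using that unfolding g_share_energy_def share_energy_def by blast
  then obtain c5 where "if g_share_energy \<kappa> c4 a then share_energy \<kappa> c4 a c5 else c5 = c4"
    by (cases "g_share_energy \<kappa> c4 a") auto
  then show ?thesis unfolding ed_exec_def using c1_def c2_def c3 c4_def by blast
qed

section \<open>Movements\<close>

lemma legalI:
  assumes "\<And>x h t. x < num c \<Longrightarrow> body c x = Expanded h t \<Longrightarrow> adjacent h t"
    and "\<And>x y v. x < num c \<Longrightarrow> y < num c \<Longrightarrow> v \<in> nodes (body c x) \<Longrightarrow> v \<in> nodes (body c y) \<Longrightarrow> x = y"
  shows "legal c"
  using assms unfolding legal_def by blast

lemma legal_expanded: "legal c \<Longrightarrow> x < num c \<Longrightarrow> body c x = Expanded h t \<Longrightarrow> adjacent h t"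
  unfolding legal_def by blast

lemma port_target_contracted:
  "body c a = Contracted u \<Longrightarrow> port_target c a p = Some v \<Longrightarrow> adjacent v u"
  using port_target_adjacent(2)[of c a p v] adjacent_sym by auto

lemma exec_move_contractE:
  assumes "exec_move (Contract s) a c = Some c'"
  obtains h t w where "body c a = Expanded h t" "w \<in> {h, t}"
    "c' = c\<lparr>body := (body c)(a := Contracted w)\<rparr>"
  using assms by (auto split: body.splits side.splits)

lemma exec_move_expandE:
  assumes "exec_move (Expand p) a c = Some c'"
  obtains u v where "body c a = Contracted u" "port_target c a p = Some v" "v \<notin> occupied c"
    "c' = c\<lparr>body := (body c)(a := Expanded v u)\<rparr>"
  using assms by (auto split: body.splits option.splits if_splits)

lemma exec_move_pushE:
  assumes "exec_move (Push p) a c = Some c'"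
  obtains u v b h t where "body c a = Contracted u" "port_target c a p = Some v"
    "neighbor_at c a p = Some b" "body c b = Expanded h t"
    "c' = c\<lparr>body := (body c)(a := Expanded v u, b := Contracted (if v = h then t else h))\<rparr>"
  using assms by (auto split: body.splits option.splits)

lemma exec_move_pullE:
  assumes "exec_move (Pull p) a c = Some c'"
  obtains h t w b x y where "body c a = Expanded h t" "neighbor_at c a p = Some b"
    "body c b = Contracted w" "x = (case fst p of Head \<Rightarrow> h | Tail \<Rightarrow> t)"
    "y = (case fst p of Head \<Rightarrow> t | Tail \<Rightarrow> h)"
    "c' = c\<lparr>body := (body c)(a := Contracted y, b := Expanded x w)\<rparr>"
  using assms by (auto split: body.splits option.splits simp: Let_def)

lemma erase_body_update: "erase (c\<lparr>body := B\<rparr>) = (erase c)\<lparr>body := B\<rparr>"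
  by (simp add: erase_def)

lemma exec_move_erase: "map_option erase (exec_move m a c) = exec_move m a (erase c)"
proof (cases m)
  case (Contract s)
  then show ?thesis by (cases "body c a") (simp_all add: erase_body_update)
next
  case (Expand p)
  have "occupied (erase c) = occupied c" by (simp add: occupied_def)
  then show ?thesis using Expand
    by (cases "body c a"; cases "port_target c a p") (simp_all add: erase_body_update)
next
  case (Push p)
  then show ?thesis
    by (cases "body c a"; cases "port_target c a p"; cases "neighbor_at c a p";
        cases "body c (the (neighbor_at c a p))") (simp_all add: erase_body_update)
next
  case (Pull p)
  then show ?thesis
    by (cases "body c a"; cases "neighbor_at c a p"; cases "body c (the (neighbor_at c a p))")
      (simp_all add: erase_body_update Let_def)
qed

lemma exec_move_frame:
  "exec_move m a c = Some c' \<Longrightarrow> num c' = num c \<and> mem c' = mem c \<and> orient c' = orient c"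
  by (cases m) (auto split: body.splits option.splits if_splits simp: Let_def)

lemma legal_contract:
  assumes "legal c" "exec_move (Contract s) a c = Some c'"
  shows "legal c'"
proof -
  obtain h t w where 1: "body c a = Expanded h t" "w \<in> {h, t}"
    and 2: "c' = c\<lparr>body := (body c)(a := Contracted w)\<rparr>"
    using assms(2) by (rule exec_move_contractE)
  have sub: "nodes (body c' x) \<subseteq> nodes (body c x)" and n: "num c' = num c" for x
    using 1 2 by auto
  show ?thesis
  proof (rule legalI, unfold n)
    show "adjacent h t" if "x < num c" "body c' x = Expanded h t" for x h t
      using that legal_expanded[OF assms(1)] 2 by (auto split: if_splits)
    show "x = y" if "x < num c" "y < num c" "v \<in> nodes (body c' x)" "v \<in> nodes (body c' y)" for x y v
      using that sub legal_unique[OF assms(1), of x y v] by blast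
  qed
qed

lemma legal_expand:
  assumes "legal c" "exec_move (Expand p) a c = Some c'"
  shows "legal c'"
proof -
  obtain u v where 1: "body c a = Contracted u" "port_target c a p = Some v" "v \<notin> occupied c"
    and 2: "c' = c\<lparr>body := (body c)(a := Expanded v u)\<rparr>"
    using assms(2) by (rule exec_move_expandE)
  have "v \<notin> nodes (body c x)" if "x < num c" for x using 1 that by (auto simp: occupied_def)
  then show ?thesis
    using legal_unique[OF assms(1)] legal_expanded[OF assms(1)] 2 1 port_target_contracted[OF 1(1,2)]
    by (intro legalI) (fastforce split: if_splits)+
qed

lemma push_nodes:
  assumes "legal c" "neighbor_at c a p = Some b" "port_target c a p = Some v" "body c b = Expanded h t"
  shows "b < num c" "a \<noteq> b" "{v, if v = h then t else h} = {h, t}" "v \<noteq> (if v = h then t else h)"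
proof -
  have v: "b < num c" "v \<in> nodes (body c b)"
    using assms neighbor_at_iff by fastforce+
  then show "b < num c" by simp
  show "a \<noteq> b" using v port_target_adjacent(1)[OF assms(3)] by auto
  have "h \<noteq> t" using legal_expanded[OF assms(1) v(1) assms(4)] adjacent_irrefl[of h] by blast
  then show "{v, if v = h then t else h} = {h, t}" "v \<noteq> (if v = h then t else h)"
    using v assms(4) by auto
qed

lemma legal_push:
  assumes "legal c" "exec_move (Push p) a c = Some c'" "a < num c"
  shows "legal c'"
proof -
  obtain u v b h t where 1: "body c a = Contracted u" "port_target c a p = Some v"
    "neighbor_at c a p = Some b" "body c b = Expanded h t"
    and c': "c' = c\<lparr>body := (body c)(a := Expanded v u, b := Contracted (if v = h then t else h))\<rparr>"
    using assms(2) by (rule exec_move_pushE)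
  define w where "w = (if v = h then t else h)"
  note b = push_nodes[OF assms(1) 1(3,2,4), folded w_def]
  have B: "body c' x = (if x = b then Contracted w else if x = a then Expanded v u else body c x)" for x
    by (simp add: c' w_def)
  have n: "num c' = num c" by (simp add: c')
  have vw: "v \<in> nodes (body c b)" "w \<in> nodes (body c b)" "u \<in> nodes (body c a)"
    using b(3) 1 by auto
  note U = legal_unique[OF assms(1)]
  show ?thesis
  proof (rule legalI, unfold n)
    fix x h t assume "x < num c" "body c' x = Expanded h t"
    then show "adjacent h t"
      using legal_expanded[OF assms(1)] port_target_contracted[OF 1(1,2)] by (auto simp: B split: if_splits)
  next
    fix x y z assume xy: "x < num c" "y < num c" "z \<in> nodes (body c' x)" "z \<in> nodes (body c' y)"
    \<comment> \<open>\<open>q\<close> sends the new owner of the node \<open>z\<close> to its old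
      owner. Only \<open>v\<close> has changed hands, from \<open>b\<close> to \<open>a\<close>, so
      uniqueness carries over from \<open>c\<close>.\<close>
    define q where "q x = (if x = a \<and> z = v then b else x)" for x
    have q: "z \<in> nodes (body c (q x)) \<and> q x < num c \<and> (x = b \<longrightarrow> z \<noteq> v)"
      if "z \<in> nodes (body c' x)" "x < num c" for x
      using that vw b 1(1) assms(3) by (auto simp: B q_def split: if_splits)
    have "q x = q y" using U[of "q x" "q y" z] q[OF xy(3,1)] q[OF xy(4,2)] by blast
    moreover have "z \<noteq> v \<or> x \<noteq> b" "z \<noteq> v \<or> y \<noteq> b" using q[OF xy(3,1)] q[OF xy(4,2)] by blast+
    ultimately show "x = y" by (auto simp: q_def split: if_splits)
  qed
qed

lemma pull_nodes:
  assumes "legal c" "neighbor_at c a p = Some b" "body c a = Expanded h t" "body c b = Contracted w"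
    and "x = (case fst p of Head \<Rightarrow> h | Tail \<Rightarrow> t)" "a < num c"
  shows "b < num c" "a \<noteq> b" "adjacent x w" "h \<noteq> t"
proof -
  obtain v where v: "port_target c a p = Some v" "b < num c" "v \<in> nodes (body c b)"
    using assms neighbor_at_iff by blast
  then show "b < num c" by simp
  show "a \<noteq> b" using assms(3,4) by auto
  have "v = w" using v assms(4) by simp
  then show "adjacent x w"
    using v(1) assms(3,5) by (cases p; cases "fst p") (auto simp: port_target_def Let_def adjacent_def split: if_splits)
  show "h \<noteq> t" using legal_expanded[OF assms(1,6,3)] adjacent_irrefl[of h] by blast
qed

lemma legal_pull:
  assumes "legal c" "exec_move (Pull p) a c = Some c'" "a < num c"
  shows "legal c'"
proof -
  obtain h t w b x y where 1: "body c a = Expanded h t" "neighbor_at c a p = Some b"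
    "body c b = Contracted w" "x = (case fst p of Head \<Rightarrow> h | Tail \<Rightarrow> t)"
    "y = (case fst p of Head \<Rightarrow> t | Tail \<Rightarrow> h)"
    and c': "c' = c\<lparr>body := (body c)(a := Contracted y, b := Expanded x w)\<rparr>"
    using assms(2) by (rule exec_move_pullE)
  note b = pull_nodes[OF assms(1) 1(2,1,3,4) assms(3)]
  have B: "body c' z = (if z = b then Expanded x w else if z = a then Contracted y else body c z)" for z
    by (simp add: c')
  have n: "num c' = num c" by (simp add: c')
  have xy: "x \<in> nodes (body c a)" "y \<in> nodes (body c a)" "w \<in> nodes (body c b)" "x \<noteq> y"
    using 1 b by (auto split: side.splits)
  note U = legal_unique[OF assms(1)]
  show ?thesis
  proof (rule legalI, unfold n)
    fix x h t assume "x < num c" "body c' x = Expanded h t"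
    then show "adjacent h t"
      using legal_expanded[OF assms(1)] b by (auto simp: B split: if_splits)
  next
    fix e f z assume ef: "e < num c" "f < num c" "z \<in> nodes (body c' e)" "z \<in> nodes (body c' f)"
    \<comment> \<open>Again the old owner of \<open>z\<close>: only the vacated node
      \<open>x\<close> has changed hands, from \<open>a\<close> to \<open>b\<close>.\<close>
    define q where "q e = (if e = b \<and> z = x then a else e)" for e
    have q: "z \<in> nodes (body c (q e)) \<and> q e < num c \<and> (e = a \<longrightarrow> z \<noteq> x)"
      if "z \<in> nodes (body c' e)" "e < num c" for e
      using that xy b assms(3) by (auto simp: B q_def split: if_splits)
    have "q e = q f" using U[of "q e" "q f" z] q[OF ef(3,1)] q[OF ef(4,2)] by blast
    moreover have "z \<noteq> x \<or> e \<noteq> a" "z \<noteq> x \<or> f \<noteq> a" using q[OF ef(3,1)] q[OF ef(4,2)] by blast+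
    ultimately show "e = f" by (auto simp: q_def split: if_splits)
  qed
qed

section \<open>Movements preserve the forest\<close>

lemma port_target_cong:
  "orient c' = orient c \<Longrightarrow> body c' v = body c v \<Longrightarrow> port_target c' v = port_target c v"
  by (rule ext) (simp add: port_target_def)

text \<open>The old node becomes the tail, so tail ports keep their labels; the only one lost leads
  into the new head.\<close>

lemma port_node_expanded:
  "port_node ori (Contracted w) p = Some t \<Longrightarrow> t \<noteq> x \<Longrightarrow> port_node ori (Expanded x w) p = Some t"
  by (cases p; cases "fst p") (auto simp: Let_def)

text \<open>A movement leaves memories alone, so the forest is the same if every parent port still
  leads to the same amoebot. No edge can arise, since in a sound configuration every parent port is
  already attached.\<close>

lemma sound_moved:
  assumes "sound \<kappa> c" "legal c'" "exec_move m a c = Some c'"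
    and "\<And>v p q t. v < num c \<Longrightarrow> parent (mem c v) = Some p \<Longrightarrow> par c v = Some q \<Longrightarrow>
      port_target c v p = Some t \<Longrightarrow> q < num c \<Longrightarrow> t \<in> nodes (body c q) \<Longrightarrow>
      port_target c' v p = Some t \<and> t \<in> nodes (body c' q)"
  shows "sound \<kappa> c'"
proof -
  note c = soundD[OF assms(1)]
  have n: "num c' = num c" and m: "mem c' = mem c"
    using exec_move_frame[OF assms(3)] by simp_all
  have p: "par c' = par c"
  proof
    fix v
    show "par c' v = par c v"
    proof (cases "v < num c \<and> parent (mem c v) \<noteq> None")
      case True
      then obtain p where p: "parent (mem c v) = Some p" by auto
      obtain q where q: "par c v = Some q" using c(3)[of v] True by auto
      then have "neighbor_at c v p = Some q" using True p by (simp add: par_def)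
      then obtain t where t: "port_target c v p = Some t" "q < num c" "t \<in> nodes (body c q)"
        using neighbor_at_iff[OF c(1)] by blast
      then have "neighbor_at c' v p = Some q"
        using assms(4)[OF _ p q t] True n neighbor_at_iff[OF assms(2)] by metis
      then show ?thesis using q p True by (simp add: par_def n m)
    qed (auto simp: par_def n m)
  qed
  show ?thesis
    using c by (intro soundI; (unfold n m p)?) (simp_all add: assms(2))
qed

text \<open>Only the body of \<open>a\<close> changes, and \<open>a\<close> is isolated in the
  forest.\<close>

lemma sound_contract:
  assumes "sound \<kappa> c" "a < num c" "exec_move (Contract s) a c = Some c'"
    and "par c a = None" "\<And>b. par c b \<noteq> Some a"
  shows "sound \<kappa> c'"
proof (rule sound_moved[OF assms(1) _ assms(3)])
  show "legal c'" using legal_contract[OF soundD(1)[OF assms(1)] assms(3)] .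
  fix v p q t assume v: "par c v = Some q" "port_target c v p = Some t" "t \<in> nodes (body c q)"
  then have "v \<noteq> a" "q \<noteq> a" using assms(4,5) by auto
  moreover obtain w where "c' = c\<lparr>body := (body c)(a := Contracted w)\<rparr>"
    using assms(3) by (rule exec_move_contractE)
  ultimately have "body c' v = body c v" "body c' q = body c q"
    by simp_all
  then show "port_target c' v p = Some t \<and> t \<in> nodes (body c' q)"
    using v exec_move_frame[OF assms(3)] port_target_cong[of c' c v] by simp
qed

text \<open>The new node was unoccupied, so no parent port leads into it, and all other edges
  survive.\<close>

lemma sound_expand:
  assumes "sound \<kappa> c" "a < num c" "exec_move (Expand p) a c = Some c'"
  shows "sound \<kappa> c'"
proof (rule sound_moved[OF assms(1) _ assms(3)])
  show "legal c'" using legal_expand[OF soundD(1)[OF assms(1)] assms(3)] .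
  obtain u w where 1: "body c a = Contracted u" "port_target c a p = Some w" "w \<notin> occupied c"
    and c': "c' = c\<lparr>body := (body c)(a := Expanded w u)\<rparr>"
    using assms(3) by (rule exec_move_expandE)
  fix v p q t
  assume v: "port_target c v p = Some t" "q < num c" "t \<in> nodes (body c q)"
  then have "t \<noteq> w" using 1 by (auto simp: occupied_def)
  then show "port_target c' v p = Some t \<and> t \<in> nodes (body c' q)"
    using v 1 c' by (auto simp: port_target_def port_node_expanded)
qed

text \<open>The isolated \<open>a\<close> affects no edge. The amoebot \<open>b\<close> keeps its
  node as tail and gains only a node of \<open>a\<close>, to which no parent port leads.\<close>

lemma sound_pull:
  assumes "sound \<kappa> c" "a < num c" "exec_move (Pull p) a c = Some c'"
    and "par c a = None" "\<And>b. par c b \<noteq> Some a"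
  shows "sound \<kappa> c'"
proof (rule sound_moved[OF assms(1) _ assms(3)])
  note c = soundD[OF assms(1)]
  show "legal c'" using legal_pull[OF c(1) assms(3,2)] .
  obtain h t w b x y where 1: "body c a = Expanded h t" "neighbor_at c a p = Some b"
    "body c b = Contracted w" "x = (case fst p of Head \<Rightarrow> h | Tail \<Rightarrow> t)"
    "y = (case fst p of Head \<Rightarrow> t | Tail \<Rightarrow> h)"
    and c': "c' = c\<lparr>body := (body c)(a := Contracted y, b := Expanded x w)\<rparr>"
    using assms(3) by (rule exec_move_pullE)
  note b = pull_nodes[OF c(1) 1(2,1,3,4) assms(2)]
  have x: "x \<in> nodes (body c a)" using 1 by (auto split: side.splits)
  fix v p q t
  assume v: "par c v = Some q" "port_target c v p = Some t" "q < num c" "t \<in> nodes (body c q)"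
  then have va: "v \<noteq> a" "q \<noteq> a" using assms(4,5) by auto
  then have "t \<noteq> x" using legal_unique[OF c(1) v(3) assms(2) v(4)] x by auto
  then show "port_target c' v p = Some t \<and> t \<in> nodes (body c' q)"
    using v 1(3) va c' by (auto simp: port_target_def port_node_expanded)
qed

text \<open>The children of the pushed amoebot \<open>b\<close> that were attached to the node it gives up become
  children of the pushing amoebot \<open>a\<close>.\<close>

lemma (in forest) forest_push:
  assumes "a < n" "b < n" "pa' a = None" "pa' b = None"
    and "\<And>v. v \<noteq> a \<Longrightarrow> v \<noteq> b \<Longrightarrow> pa' v = pa v \<or> pa v = Some b \<and> pa' v = Some a"
  shows "forest n src (st(a := Pruning, b := Pruning)) pa'"
proof
  fix v assume v: "v < n"
  show "src v \<Longrightarrow> (st(a := Pruning, b := Pruning)) v \<in> {Source, Pruning}"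
    using source_state[OF v] by auto
  show "\<not> src v \<Longrightarrow> (st(a := Pruning, b := Pruning)) v \<noteq> Source"
    using nonsource_state[OF v] by auto
  show "pa' v = None \<longleftrightarrow> (st(a := Pruning, b := Pruning)) v \<in> {Source, Idle, Pruning}"
    using root_iff[OF v] assms by (cases "v = a \<or> v = b") fastforce+
next
  fix v u assume vu: "pa' v = Some u"
  then have "v \<noteq> a" "v \<noteq> b" using assms by auto
  then have "pa v = Some u \<or> pa v = Some b \<and> u = a" using assms(5)[of v] vu by auto
  then show "v < n \<and> u < n \<and> (st(a := Pruning, b := Pruning)) u \<noteq> Idle"
    using parent[of v u] parent[of v b] assms by auto
next
  obtain f :: "nat \<Rightarrow> nat" where f: "\<And>v u. pa v = Some u \<Longrightarrow> f u < f v"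
    using ranked by blast
  \<comment> \<open>\<open>a\<close> and \<open>b\<close> are now roots and can both get the lowest
    rank, so redirecting an edge from \<open>b\<close> to \<open>a\<close> does no harm.\<close>
  have "(if u \<in> {a, b} then 0 else Suc (f u)) < (if v \<in> {a, b} then 0 else Suc (f v))"
    if vu: "pa' v = Some u" for v u
  proof -
    have "v \<noteq> a" "v \<noteq> b" using assms vu by auto
    then show ?thesis using assms(5)[of v] vu f[of v u] by auto
  qed
  then show "\<exists>f :: nat \<Rightarrow> nat. \<forall>v u. pa' v = Some u \<longrightarrow> f u < f v"
    by (intro exI[of _ "\<lambda>v. if v \<in> {a, b} then 0 else Suc (f v)"]) blast
qed

lemma sound_push:
  assumes "sound \<kappa> c" "a < num c" "exec_move (Push p) a (before_move (Push p) a c) = Some c'"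
  shows "sound \<kappa> c'"
proof -
  note c = soundD[OF assms(1)]
  let ?d = "before_move (Push p) a c"
  have d: "?d = c\<lparr>mem := mem ?d\<rparr>" by (simp add: before_move_def update_mem_def Let_def split: option.split)
  obtain u v b h t where 1: "body ?d a = Contracted u" "port_target ?d a p = Some v"
    "neighbor_at ?d a p = Some b" "body ?d b = Expanded h t"
    and c': "c' = ?d\<lparr>body := (body ?d)(a := Expanded v u, b := Contracted (if v = h then t else h))\<rparr>"
    using assms(3) by (rule exec_move_pushE)
  have same: "legal ?d = legal c" "neighbor_at ?d = neighbor_at c" "num ?d = num c" "body ?d = body c"
    "orient ?d = orient c"
    by (subst d, simp)+
  have ld: "legal ?d" using c same by simp
  have l: "legal c'" using legal_push[OF ld assms(3)] assms(2) same by simp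
  note b = push_nodes[OF ld 1(3,2,4)]
  have fr: "num c' = num c" "mem c' = mem ?d" "orient c' = orient c"
    using exec_move_frame[OF assms(3)] same by auto
  have nb: "neighbor_at c a p = Some b" using 1(3) unfolding same .
  have bodies: "body c a = Contracted u" "body c b = Expanded h t" using 1(1,4) unfolding same .
  have m: "mem ?d = (mem c)(a := (mem c a)\<lparr>parent := None, state := Pruning\<rparr>,
      b := (mem c b)\<lparr>parent := None, state := Pruning\<rparr>)"
    using nb b(2) by (simp add: before_move_def update_mem_def Let_def)
  have st: "states c' = (states c)(a := Pruning, b := Pruning)"
    and eb: "charge c' = charge c" and so: "sources c' = sources c" by (auto simp: fr m)
  have B: "body c' x = (if x = b then Contracted (if v = h then t else h)
      else if x = a then Expanded v u else body c x)" for x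
    by (simp add: c' same)
  have roots: "par c' a = None" "par c' b = None" using b(2) by (simp_all add: par_def fr m)
  have raw: "parent (mem c' x) = (if x = a \<or> x = b then None else parent (mem c x))" for x
    by (simp add: fr m)
  \<comment> \<open>The parent port of \<open>x\<close> still leads to the same node
    \<open>z\<close>; its owner changes only if \<open>z\<close> is the node \<open>v\<close> that
    \<open>b\<close> hands to \<open>a\<close>.\<close>
  have redirect: "par c' x = par c x \<or> par c x = Some b \<and> par c' x = Some a"
    if x: "x \<noteq> a" "x \<noteq> b" for x
  proof (cases "x < num c \<and> parent (mem c x) \<noteq> None")
    case True
    then obtain p where p: "parent (mem c x) = Some p" by auto
    obtain q where q: "par c x = Some q" using c(3)[of x] True by auto
    then have "neighbor_at c x p = Some q" using True p by (simp add: par_def)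
    then obtain z where z: "port_target c x p = Some z" "q < num c" "z \<in> nodes (body c q)"
      using neighbor_at_iff[OF c(1)] by blast
    have "port_target c' x p = Some z"
      using z(1) port_target_cong[of c' c x] x by (simp add: fr B)
    then have at: "neighbor_at c' x p = Some r" if "z \<in> nodes (body c' r)" "r < num c" for r
      using neighbor_at_iff[OF l] that fr by metis
    have par: "par c' x = neighbor_at c' x p" using True p x by (simp add: par_def fr m)
    show ?thesis
    proof (cases "q = b \<and> z = v")
      case True
      have "neighbor_at c' x p = Some a" by (rule at) (use True b(2) assms(2) in \<open>auto simp: B\<close>)
      then have "par c' x = Some a" by (rule trans[OF par])
      then show ?thesis using q True by blast
    next
      case False
      have "z \<in> nodes (body c' q)"
      proof (cases "q = b")
        case True
        then have "z \<in> {v, if v = h then t else h}" using z(3) b(3) bodies by simp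
        then show ?thesis using True False by (simp add: B)
      next
        case False
        then show ?thesis using z(3) bodies by (cases "q = a") (simp_all add: B)
      qed
      then have "neighbor_at c' x p = Some q" by (rule at) (rule z(2))
      then have "par c' x = par c x" unfolding q by (rule trans[OF par])
      then show ?thesis ..
    qed
  qed (use x in \<open>auto simp: par_def raw fr(1)\<close>)
  have f: "forest (num c) (sources c) ((states c)(a := Pruning, b := Pruning)) (par c')"
    using b(1) same by (intro forest.forest_push[OF c(2) assms(2) _ roots redirect]) simp_all
  show ?thesis
  proof (rule soundI; (unfold fr(1) st so)?)
    show "parent (mem c' x) = None \<or> par c' x \<noteq> None" if "x < num c" for x
      using redirect[of x] c(3)[OF that] by (auto simp: raw)
    show "ebat (mem c' x) \<le> \<kappa>" if "x < num c" for x
      using c(4)[OF that] fun_cong[OF eb] by simp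
    show "\<exists>x<num c. sources c' x" using c(5) fun_cong[OF so] by simp
  qed (use l f in simp_all)
qed

lemma sound_detach:
  assumes "sound \<kappa> c" "a < num c"
  defines "d \<equiv> prune a (update_mem a (\<lambda>m. m\<lparr>parent := None\<rparr>) c)"
  shows "sound \<kappa> d" "num d = num c" "par d a = None" "par d b \<noteq> Some a"
proof -
  note c = soundD[OF assms(1)]
  let ?e = "update_mem a (\<lambda>m. m\<lparr>parent := None\<rparr>) c"
  have l: "legal ?e" and p: "parent (mem ?e a) = None" using c by (simp_all add: update_mem_def)
  have ns: "par c x \<noteq> Some x" for x using forest.no_self_parent[OF c(2)] .
  have pe: "par ?e = (par c)(a := None)" by (auto simp: par_def update_mem_def)
  have st: "states d = pruned_st (sources c) (states c) (par c) a"
    unfolding d_def states_prune[OF l] pe using ns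
    by (auto simp: pruned_st_def update_mem_def)
  have pa: "par d = pruned_pa (par c) a"
    unfolding d_def par_prune[OF l p] pe by (auto simp: pruned_pa_def)
  have so: "sources d = sources c" and n: "num d = num c" and ld: "legal d"
    using l by (auto simp: d_def update_mem_def)
  have eb: "charge d = charge c" by (auto simp: d_def update_mem_def)
  show "sound \<kappa> d"
  proof (rule soundI; (unfold n so st pa)?)
    show "parent (mem d b) = None \<or> pruned_pa (par c) a b \<noteq> None" if "b < num c" for b
      using c(3)[OF that] unfolding d_def parent_prune[OF l] pe
      by (auto simp: pruned_pa_def update_mem_def)
    show "ebat (mem d x) \<le> \<kappa>" if "x < num c" for x
      using c(4)[OF that] fun_cong[OF eb] by simp
    show "\<exists>x<num c. sources d x" using c(5) fun_cong[OF so] by simp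
  qed (use ld forest.forest_pruned[OF c(2) assms(2)] in simp_all)
  show "num d = num c" by (rule n)
  show "par d a = None" "par d b \<noteq> Some a" by (simp_all add: pa pruned_pa_def)
qed

lemma sound_move:
  assumes "sound \<kappa> c" "a < num c" "exec_move m a (before_move m a c) = Some c'"
  shows "sound \<kappa> c'"
proof (cases m)
  case (Contract s)
  then show ?thesis
    using sound_contract[of \<kappa> _ a s c'] sound_detach[OF assms(1,2)] assms(2,3)
    by (simp add: before_move_def del: exec_move.simps)
next
  case (Expand p)
  then show ?thesis
    using sound_expand[OF assms(1,2)] assms(3) by (simp add: before_move_def del: exec_move.simps)
next
  case (Push p)
  then show ?thesis using sound_push assms by blast
next
  case (Pull p)
  then show ?thesis
    using sound_pull[of \<kappa> _ a p c'] sound_detach[OF assms(1,2)] assms(2,3)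
    by (simp add: before_move_def del: exec_move.simps)
qed

section \<open>Actions of the given algorithm\<close>

lemma run_compute:
  "phase_structured ops \<Longrightarrow> run ops a c = Option.bind (compute ops a c)
    (\<lambda>(b, mv). case mv of None \<Rightarrow> Some b | Some m \<Rightarrow> exec_move m a b)"
  by (induction ops arbitrary: c) (auto split: option.split)

lemma compute_frame:
  "compute ops a c = Some (b, mv) \<Longrightarrow> num b = num c \<and> orient b = orient c \<and> body b = body c"
  by (induction ops arbitrary: c) (auto split: option.splits if_splits)

lemma erase_copy_base:
  "num b = num c \<Longrightarrow> orient b = orient c \<Longrightarrow> body b = body c \<Longrightarrow> erase (copy_base b c) = b"
  by (simp add: erase_def copy_base_def)

lemma erase_before_move: "erase (before_move m a c) = erase c"
  by (simp add: before_move_def erase_update_mem Let_def split: movement.split option.split)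

lemma energy_exec_run:
  assumes "phase_structured ops" "energy_exec ops d c a c'"
  shows "run ops a (erase c) = Some (erase c')"
proof -
  define c1 where "c1 = update_mem a (\<lambda>m. m\<lparr>ebat := ebat m - d\<rparr>) c"
  have e: "erase c1 = erase c" unfolding c1_def by (rule erase_update_mem) simp
  obtain b mv where b: "compute ops a (erase c1) = Some (b, mv)"
    and mv: "case mv of None \<Rightarrow> c' = copy_base b c1
           | Some m \<Rightarrow> exec_move m a (before_move m a (copy_base b c1)) = Some c'"
    using assms(2) unfolding energy_exec_def c1_def Let_def by blast
  have eb: "erase (copy_base b c1) = b" using compute_frame[OF b] by (simp add: erase_copy_base)
  show ?thesis
  proof (cases mv)
    case None
    then show ?thesis using b mv eb by (simp add: run_compute[OF assms(1)] e)
  next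
    case (Some m)
    then have "exec_move m a (before_move m a (copy_base b c1)) = Some c'" using mv by simp
    then have "exec_move m a b = Some (erase c')"
      using exec_move_erase[of m a "before_move m a (copy_base b c1)"] eb
      by (simp add: erase_before_move)
    then show ?thesis using b Some by (simp add: run_compute[OF assms(1)] e)
  qed
qed

lemma energy_exec_exists:
  assumes "phase_structured ops" "run ops a (erase c) \<noteq> None"
  shows "\<exists>c'. energy_exec ops d c a c'"
proof -
  define c1 where "c1 = update_mem a (\<lambda>m. m\<lparr>ebat := ebat m - d\<rparr>) c"
  have e: "erase c1 = erase c" unfolding c1_def by (rule erase_update_mem) simp
  obtain b mv where b: "compute ops a (erase c1) = Some (b, mv)"
    using assms e by (cases "compute ops a (erase c)") (auto simp: run_compute)
  have eb: "erase (copy_base b c1) = b" using compute_frame[OF b] by (simp add: erase_copy_base)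
  have "\<exists>c'. case mv of None \<Rightarrow> c' = copy_base b c1
           | Some m \<Rightarrow> exec_move m a (before_move m a (copy_base b c1)) = Some c'"
  proof (cases mv)
    case (Some m)
    have "exec_move m a b \<noteq> None" using assms b Some by (simp add: run_compute e)
    then have "exec_move m a (before_move m a (copy_base b c1)) \<noteq> None"
      using exec_move_erase[of m a "before_move m a (copy_base b c1)"] eb
      by (auto simp: erase_before_move)
    then show ?thesis using Some by auto
  qed simp
  then show ?thesis using b unfolding energy_exec_def c1_def Let_def by blast
qed

lemma sound_energy_exec:
  assumes "sound \<kappa> c" "a < num c" "energy_exec ops d c a c'"
  shows "sound \<kappa> c'"
proof -
  note c = soundD[OF assms(1)]
  define c1 where "c1 = update_mem a (\<lambda>m. m\<lparr>ebat := ebat m - d\<rparr>) c"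
  obtain b mv where mv: "case mv of None \<Rightarrow> c' = copy_base b c1
           | Some m \<Rightarrow> exec_move m a (before_move m a (copy_base b c1)) = Some c'"
    using assms(3) unfolding energy_exec_def c1_def Let_def by blast
  let ?d = "copy_base b c1"
  have raw: "parent (mem ?d x) = parent (mem c x)" "state (mem ?d x) = state (mem c x)"
    "is_source (mem ?d x) = is_source (mem c x)" "ebat (mem ?d x) \<le> ebat (mem c x)" for x
    by (simp_all add: copy_base_def c1_def update_mem_def)
  have same: "num ?d = num c" "neighbor_at ?d = neighbor_at c" "legal ?d = legal c"
    by (simp_all add: copy_base_def c1_def update_mem_def)
  have p: "par ?d = par c" by (rule ext) (simp add: par_def raw same)
  have "sound \<kappa> ?d"
  proof (rule soundI; (unfold same raw p)?)
    show "ebat (mem ?d x) \<le> \<kappa>" if "x < num c" for x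
      using c(4)[OF that] raw(4)[of x] by simp
  qed (use c in simp_all)
  then show ?thesis using mv sound_move[of \<kappa> ?d a _ c'] assms(2) same by (auto split: option.splits)
qed

section \<open>Terminal configurations\<close>

lemma connected_erase: "connected_config (erase c) = connected_config c"
proof -
  have "occupied (erase c) = occupied c" by (simp add: occupied_def)
  then show ?thesis by (simp add: connected_config_def)
qed

text \<open>Calls and adoptions still possible would show up in the guard. A walk through occupied
  nodes from a source then spreads being non-idle to everyone.\<close>

lemma quiet_not_idle:
  assumes "sound \<kappa> c" "connected_config c"
    and quiet: "\<And>a. a < num c \<Longrightarrow> \<not> ed_guard \<kappa> c a"
    and "a < num c"
  shows "state (mem c a) \<in> {Source, Active}"
proof -
  note c = soundD[OF assms(1)]
  interpret forest "num c" "sources c" "states c" "par c" by (rule c(2))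
  have no: "\<not> g_get_pruned c v" "\<not> g_ask_growth c v" "\<not> g_grow_forest c v" if "v < num c" for v
    using quiet[OF that] by (auto simp: ed_guard_def)
  \<comment> \<open>By induction from the root, the parent of an asking amoebot is not asking
    itself. In each remaining state its asking child, or its own state, enables the parent.\<close>
  have asking: "v < num c \<longrightarrow> state (mem c v) \<noteq> Asking" for v
  proof (induction v rule: ancestor_induct)
    case (step v)
    show ?case
    proof (intro impI notI)
      assume v: "v < num c" "state (mem c v) = Asking"
      then obtain u where u: "par c v = Some u" using root_iff[of v] by (cases "par c v") auto
      then have "u < num c" "state (mem c u) \<noteq> Idle" using parent by blast+
      moreover have "v \<in> asking_children c u"
        using v u by (simp add: asking_children_def children_eq[OF c(1)])
      moreover have "state (mem c u) \<noteq> Asking" using step[OF u] \<open>u < num c\<close> by simp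
      ultimately show False
        using no[of u] by (cases "state (mem c u)")
          (auto simp: g_get_pruned_def g_ask_growth_def g_grow_forest_def)
    qed
  qed
  have busy: "state (mem c v) \<in> {Source, Active}" if "v < num c" "state (mem c v) \<noteq> Idle" for v
    using that no[of v] asking[of v] by (cases "state (mem c v)")
      (auto simp: g_get_pruned_def g_grow_forest_def)
  obtain r where r: "r < num c" "is_source (mem c r)" using c(5) by blast
  then have "state (mem c r) \<noteq> Idle" using source_state[of r] by auto
  obtain x where x: "x \<in> nodes (body c r)" by (cases "body c r") auto
  obtain y where y: "y \<in> nodes (body c a)" by (cases "body c a") auto
  have "x \<in> occupied c" "y \<in> occupied c" using x y r assms(4) by (auto simp: occupied_def)
  then have "(x, y) \<in> {(x, y). x \<in> occupied c \<and> y \<in> occupied c \<and> adjacent x y}\<^sup>*"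
    using assms(2) by (auto simp: connected_config_def)
  then have "\<forall>b<num c. y \<in> nodes (body c b) \<longrightarrow> state (mem c b) \<noteq> Idle"
  proof (induction rule: rtrancl_induct)
    case base
    show ?case
    proof (intro allI impI)
      fix b assume "b < num c" "x \<in> nodes (body c b)"
      then have "b = r" using legal_unique[OF c(1) _ r(1) _ x] by blast
      then show "state (mem c b) \<noteq> Idle" using \<open>state (mem c r) \<noteq> Idle\<close> by simp
    qed
  next
    case (step y z)
    show ?case
    proof (intro allI impI notI)
      fix b assume b: "b < num c" "z \<in> nodes (body c b)" "state (mem c b) = Idle"
      obtain d where d: "d < num c" "y \<in> nodes (body c d)" using step.hyps by (auto simp: occupied_def)
      then have nd: "state (mem c d) \<noteq> Idle" using step.IH by blast
      then have "b \<noteq> d" using b by auto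
      then have "b \<in> idle_neighbors c d"
        using step.hyps b d by (auto simp: idle_neighbors_def neighbors_def)
      then show False
        using no[OF d(1)] busy[OF d(1) nd] by (auto simp: g_ask_growth_def g_grow_forest_def)
    qed
  qed
  then show ?thesis using busy[OF assms(4)] y assms(4) by blast
qed

text \<open>From the roots downwards: a source that is not full would harvest, and a full parent,
  having at least one unit, would share with a child that is not full.\<close>

lemma quiet_charged:
  assumes "sound \<kappa> c" "connected_config c" "0 < \<kappa>"
    and quiet: "\<And>a. a < num c \<Longrightarrow> \<not> ed_guard \<kappa> c a"
    and "a < num c"
  shows "ebat (mem c a) = \<kappa>"
proof -
  note c = soundD[OF assms(1)]
  interpret forest "num c" "sources c" "states c" "par c" by (rule c(2))
  have no: "\<not> g_harvest_energy \<kappa> c v" "\<not> g_share_energy \<kappa> c v" if "v < num c" for v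
    using quiet[OF that] by (auto simp: ed_guard_def)
  have st: "state (mem c v) \<in> {Source, Active}" if "v < num c" for v
    by (rule quiet_not_idle[OF assms(1,2) _ that]) (rule quiet)
  have "v < num c \<longrightarrow> ebat (mem c v) = \<kappa>" for v
  proof (induction v rule: ancestor_induct)
    case (step v)
    show ?case
    proof
      assume v: "v < num c"
      have "\<not> ebat (mem c v) < \<kappa>"
      proof (cases "par c v")
        case None
        then have "state (mem c v) = Source" using root_iff[OF v] st[OF v] by auto
        then show ?thesis using no(1)[OF v] by (simp add: g_harvest_energy_def)
      next
        case (Some u)
        then have u: "u < num c" using parent by blast
        then have "ebat (mem c u) = \<kappa>" using step[OF Some] by simp
        moreover have "v \<in> children c u" using Some by (simp add: children_eq[OF c(1)])
        ultimately show ?thesis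
          using no(2)[OF u] st[OF u] assms(3) by (auto simp: g_share_energy_def)
      qed
      then show "ebat (mem c v) = \<kappa>" using c(4)[OF v] by simp
    qed
  qed
  then show ?thesis using assms(5) by blast
qed

lemma sound_initial:
  assumes "energy_extension c d" "legal c"
  shows "sound \<kappa> d"
proof -
  have e: "erase d = c" and src: "\<exists>a<num d. is_source (mem d a)"
    and init: "\<And>a. a < num d \<Longrightarrow> state (mem d a) = (if is_source (mem d a) then Source else Idle) \<and>
      parent (mem d a) = None \<and> ebat (mem d a) = 0"
    using assms(1) by (auto simp: energy_extension_def)
  have p: "par d = (\<lambda>_. None)" using init by (auto simp: par_def)
  have "forest (num d) (sources d) (states d) (par d)"
    unfolding p by unfold_locales (use init in auto)
  then show ?thesis using e assms(2) src init by (intro soundI) auto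
qed

section \<open>Executions\<close>

lemma step_num: "step (sem_of A) c a c' \<Longrightarrow> num c' = num c"
proof -
  have "run ops a c = Some c' \<Longrightarrow> num c' = num c" for ops
    by (induction ops arbitrary: c) (auto split: option.splits if_splits dest: exec_move_frame)
  then show "step (sem_of A) c a c' \<Longrightarrow> num c' = num c" by (auto simp: step_def sem_of_def)
qed

locale energy_run =
  fixes A :: "'m action set" and Init :: "'m config set" and \<kappa> :: nat
    and \<delta> :: "'m action \<Rightarrow> nat" and C0 :: "'m config"
    and D :: "nat \<Rightarrow> 'm emem config" and s :: "nat \<Rightarrow> nat" and L :: enat
  assumes compatible: "energy_compatible Init A"
    and capacity: "0 < \<kappa>" "\<And>\<alpha>. \<alpha> \<in> A \<Longrightarrow> \<delta> \<alpha> \<le> \<kappa>"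
    and start: "C0 \<in> Init" "legal C0" "connected_config C0" "energy_extension C0 (D 0)"
    and exec: "execution (energy_framework \<kappa> \<delta> A) D s L"
begin

abbreviation F :: "'m emem sem" where "F \<equiv> energy_framework \<kappa> \<delta> A"

text \<open>Defined by its effect rather than by the action taken. A step that settles is dropped
  from the simulation even if an action of the given algorithm caused it; the erased configuration
  is the same before and after.\<close>

definition base_step :: "nat \<Rightarrow> bool" where
  "base_step i \<longleftrightarrow> \<not> settles \<kappa> (s i) (D i) (D (Suc i))"

definition base_steps :: "nat \<Rightarrow> nat" where
  "base_steps i = card {j. j < i \<and> base_step j}"

lemma base_terminates:
  "C 0 \<in> Init \<Longrightarrow> execution (sem_of A) C s' L' \<Longrightarrow> \<exists>k. terminates_at (sem_of A) C L' k"
  using compatible unfolding energy_compatible_def by blast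

lemma base_valid:
  assumes "(g, ops) \<in> A"
  shows "phase_structured ops"
    and "legal c \<Longrightarrow> a < num c \<Longrightarrow> g (view c a) \<Longrightarrow> run ops a c \<noteq> None"
  using compatible assms unfolding energy_compatible_def by blast+

lemma step_F:
  assumes "step F c a c'" "sound \<kappa> c"
  shows "sound \<kappa> c'" "settles \<kappa> a c c' \<or> step (sem_of A) (erase c) a (erase c')"
proof -
  have a: "a < num c" using assms(1) by (simp add: step_def)
  have "ed_guard \<kappa> c a \<and> ed_exec \<kappa> c a c' \<or>
      (\<exists>(g, ops)\<in>A. energy_guard g (\<delta> (g, ops)) c a \<and> energy_exec ops (\<delta> (g, ops)) c a c')"
    using assms(1) by (auto simp: step_def energy_framework_def)
  then have "sound \<kappa> c' \<and> (settles \<kappa> a c c' \<or> step (sem_of A) (erase c) a (erase c'))"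
  proof
    assume "ed_guard \<kappa> c a \<and> ed_exec \<kappa> c a c'"
    then have "settles \<kappa> a c c'" using settles_ed[OF assms(2) a] by blast
    then show ?thesis by (simp add: settles_def)
  next
    assume "\<exists>(g, ops)\<in>A. energy_guard g (\<delta> (g, ops)) c a \<and> energy_exec ops (\<delta> (g, ops)) c a c'"
    then obtain g ops where g: "(g, ops) \<in> A" "energy_guard g (\<delta> (g, ops)) c a"
      "energy_exec ops (\<delta> (g, ops)) c a c'" by blast
    then have "phase_structured ops" by (intro base_valid)
    then have "run ops a (erase c) = Some (erase c')" using g(3) by (rule energy_exec_run)
    then have "step (sem_of A) (erase c) a (erase c')"
      using g a by (force simp: step_def sem_of_def energy_guard_def)
    then show ?thesis using sound_energy_exec[OF assms(2) a g(3)] by blast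
  qed
  then show "sound \<kappa> c'" "settles \<kappa> a c c' \<or> step (sem_of A) (erase c) a (erase c')" by blast+
qed

text \<open>Rules out stuck executions: validity is inherited through \<open>erase\<close>, and the
  energy distribution action can always be carried out.\<close>

lemma enabled_step:
  assumes "enabled F c a" "sound \<kappa> c"
  shows "\<exists>c'. step F c a c'"
proof -
  have a: "a < num c" using assms(1) by (simp add: enabled_def)
  have l: "legal c" using assms(2) by (rule soundD)
  have "ed_guard \<kappa> c a \<or> (\<exists>(g, ops)\<in>A. energy_guard g (\<delta> (g, ops)) c a)"
    using assms(1) by (auto simp: enabled_def energy_framework_def)
  then show ?thesis
  proof
    assume "ed_guard \<kappa> c a"
    moreover obtain c' where "ed_exec \<kappa> c a c'" using ed_exec_exists[OF l a] by blast
    ultimately show ?thesis using a by (auto simp: step_def energy_framework_def)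
  next
    assume "\<exists>(g, ops)\<in>A. energy_guard g (\<delta> (g, ops)) c a"
    then obtain g ops where g: "(g, ops) \<in> A" "energy_guard g (\<delta> (g, ops)) c a" by blast
    then have "phase_structured ops" and "run ops a (erase c) \<noteq> None"
      using base_valid[OF g(1)] a l g(2) by (simp_all add: energy_guard_def)
    then obtain c' where "energy_exec ops (\<delta> (g, ops)) c a c'"
      using energy_exec_exists by blast
    then show ?thesis using g a by (force simp: step_def energy_framework_def)
  qed
qed

lemma step_at: "enat i < L \<Longrightarrow> step F (D i) (s i) (D (Suc i))"
  using exec by (simp add: execution_def)

lemma sound_at: "enat i \<le> L \<Longrightarrow> sound \<kappa> (D i)"
proof (induction i)
  case 0
  show ?case using start by (intro sound_initial)
next
  case (Suc i)
  then have "enat i < L" by (cases L) auto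
  then show ?case using Suc step_F(1)[OF step_at] by simp
qed

lemma base_stepD:
  assumes "enat i < L" "base_step i"
  shows "step (sem_of A) (erase (D i)) (s i) (erase (D (Suc i)))"
  using step_F(2)[OF step_at[OF assms(1)] sound_at] assms by (simp add: base_step_def)

lemma erase_start: "erase (D 0) = C0"
  using start(4) by (simp add: energy_extension_def)

lemma reachable_at: "enat i \<le> L \<Longrightarrow> (\<lambda>x y. \<exists>a. step (sem_of A) x a y)\<^sup>*\<^sup>* C0 (erase (D i))"
proof (induction i)
  case 0
  show ?case by (simp add: erase_start)
next
  case (Suc i)
  then have i: "enat i < L" by (cases L) auto
  then have IH: "(\<lambda>x y. \<exists>a. step (sem_of A) x a y)\<^sup>*\<^sup>* C0 (erase (D i))" using Suc by simp
  show ?case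
  proof (cases "base_step i")
    case True
    show ?thesis by (rule rtranclp.rtrancl_into_rtrancl[OF IH]) (use base_stepD[OF i True] in blast)
  next
    case False
    then show ?thesis using IH by (simp add: base_step_def settles_def)
  qed
qed

lemma num_at:
  assumes "enat i \<le> L"
  shows "num (D i) = num C0"
proof -
  have "num y = num x" if "(\<lambda>x y. \<exists>a. step (sem_of A) x a y)\<^sup>*\<^sup>* x y" for x y
    using that by induction (auto dest: step_num)
  then show ?thesis using reachable_at[OF assms] erase_simps(1) by metis
qed

lemma connected_at: "enat i \<le> L \<Longrightarrow> connected_config (D i)"
proof -
  assume "enat i \<le> L"
  then have "(\<lambda>x y. \<exists>a. step (sem_of A) x a y)\<^sup>*\<^sup>* C0 (erase (D i))" by (rule reachable_at)
  then have "connected_config (erase (D i))"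
    using compatible start(2,3) unfolding energy_compatible_def by blast
  then show ?thesis by (simp add: connected_erase)
qed

lemma base_steps_0 [simp]: "base_steps 0 = 0"
  by (simp add: base_steps_def)

lemma base_steps_Suc: "base_steps (Suc i) = base_steps i + of_bool (base_step i)"
proof -
  have "{j. j < Suc i \<and> base_step j} =
      (if base_step i then insert i {j. j < i \<and> base_step j} else {j. j < i \<and> base_step j})"
    by (auto simp: less_Suc_eq)
  then show ?thesis by (simp add: base_steps_def)
qed

lemma base_steps_mono: "i \<le> j \<Longrightarrow> base_steps i \<le> base_steps j"
  unfolding base_steps_def by (rule card_mono) auto

lemma base_steps_less:
  assumes "i \<le> l" "l < j" "base_step l"
  shows "base_steps i < base_steps j"
proof -
  have "base_steps i \<le> base_steps l" using assms by (intro base_steps_mono) simp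
  also have "\<dots> < base_steps (Suc l)" using assms by (simp add: base_steps_Suc)
  also have "\<dots> \<le> base_steps j" using assms by (intro base_steps_mono) simp
  finally show ?thesis .
qed

lemma simulation:
  assumes "enat i \<le> L"
  shows "\<exists>C s'. C 0 = C0 \<and> (\<forall>j<base_steps i. step (sem_of A) (C j) (s' j) (C (Suc j))) \<and>
    C (base_steps i) = erase (D i)"
  using assms
proof (induction i)
  case 0
  show ?case by (intro exI[of _ "\<lambda>_. C0"]) (simp add: erase_start)
next
  case (Suc i)
  then have i: "enat i < L" by (cases L) auto
  then have "enat i \<le> L" by simp
  from Suc.IH[OF this] obtain C s' where C: "C 0 = C0"
    "\<And>j. j < base_steps i \<Longrightarrow> step (sem_of A) (C j) (s' j) (C (Suc j))"
    "C (base_steps i) = erase (D i)" by blast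
  show ?case
  proof (cases "base_step i")
    case True
    let ?m = "base_steps i"
    have "step (sem_of A) ((C(Suc ?m := erase (D (Suc i)))) j) ((s'(?m := s i)) j)
        ((C(Suc ?m := erase (D (Suc i)))) (Suc j))" if "j < Suc ?m" for j
      using that C base_stepD[OF i True] by (cases "j = ?m") auto
    then show ?thesis using True C
      by (intro exI[of _ "C(Suc ?m := erase (D (Suc i)))"] exI[of _ "s'(?m := s i)"])
        (simp add: base_steps_Suc)
  next
    case False
    then show ?thesis using C by (auto simp: base_steps_Suc base_step_def settles_def)
  qed
qed

lemma erase_const:
  assumes "i \<le> j" "\<And>l. i \<le> l \<Longrightarrow> l < j \<Longrightarrow> \<not> base_step l"
  shows "erase (D j) = erase (D i)"
  using assms
proof (induction j rule: dec_induct)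
  case (step j)
  then show ?case by (simp add: base_step_def settles_def)
qed simp

text \<open>Infinitely many base steps, listed in order of time, would form an infinite execution of
  the given algorithm from \<open>C0\<close>, since the erased configuration is constant in
  between.\<close>

lemma finite_base_steps:
  assumes "L = \<infinity>"
  shows "finite {i. base_step i}"
proof (rule ccontr)
  let ?S = "{i. base_step i}"
  assume inf: "infinite ?S"
  let ?e = "enumerate ?S"
  have between: "\<not> base_step l" if "Suc (?e j) \<le> l" "l < ?e (Suc j)" for j l
  proof
    assume "base_step l"
    then have "?e (Suc j) \<le> l" using that inf by (simp add: enumerate_Suc'' Least_le)
    then show False using that by simp
  qed
  have e: "base_step (?e j)" for j using enumerate_in_set[OF inf, of j] by simp
  have "step (sem_of A) (erase (D (?e j))) (s (?e j)) (erase (D (?e (Suc j))))" for j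
  proof -
    have "erase (D (?e (Suc j))) = erase (D (Suc (?e j)))"
      by (rule erase_const) (use between enumerate_step[OF inf, of j] in auto)
    then show ?thesis using base_stepD[OF _ e] assms by simp
  qed
  then have "execution (sem_of A) (\<lambda>j. erase (D (?e j))) (\<lambda>j. s (?e j)) \<infinity>"
    by (simp add: execution_def)
  moreover have "erase (D (?e 0)) = C0"
  proof -
    have "erase (D (?e 0)) = erase (D 0)"
    proof (rule erase_const)
      fix l assume "l < ?e 0"
      then show "\<not> base_step l" unfolding enumerate_0 using not_less_Least by blast
    qed simp
    then show ?thesis by (simp add: erase_start)
  qed
  ultimately obtain k where "terminates_at (sem_of A) (\<lambda>j. erase (D (?e j))) \<infinity> k"
    using base_terminates[of "\<lambda>j. erase (D (?e j))"] start(1) by auto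
  then show False by (simp add: terminates_at_def)
qed

lemma finite_length: "L \<noteq> \<infinity>"
proof
  assume L: "L = \<infinity>"
  obtain N where "\<forall>i\<in>{i. base_step i}. i < N"
    using finite_base_steps[OF L] finite_nat_set_iff_bounded by blast
  then have N: "settles \<kappa> (s i) (D i) (D (Suc i))" if "N \<le> i" for i
    using that by (fastforce simp: base_step_def)
  define f where "f i = (unrest_of (D (N + i)), potential \<kappa> (D (N + i)))" for i
  have "(f (Suc i), f i) \<in> less_than <*lex*> less_than" for i
    using N[of "N + i"] by (auto simp: f_def settles_def)
  moreover have "wf (less_than <*lex*> less_than)" by auto
  ultimately show False using wf_iff_no_infinite_down_chain by metis
qed

lemma terminates: "\<exists>k. terminates_at F D L k"
proof -
  obtain k where k: "L = enat k" using finite_length by (cases L) auto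
  have "\<not> enabled F (D k) a" for a
    using enabled_step[OF _ sound_at[of k]] exec k by (auto simp: execution_def)
  then show ?thesis using k by (auto simp: terminates_at_def)
qed

lemma base_execution:
  assumes "terminates_at F D L k"
  shows "\<exists>C s'. C 0 = C0 \<and> execution (sem_of A) C s' (enat (base_steps k)) \<and>
    terminates_at (sem_of A) C (enat (base_steps k)) (base_steps k) \<and> C (base_steps k) = erase (D k)"
proof -
  have L: "L = enat k" and dis: "\<And>a. \<not> enabled F (D k) a" using assms by (auto simp: terminates_at_def)
  have k: "sound \<kappa> (D k)" "connected_config (D k)" using sound_at connected_at L by simp_all
  have quiet: "\<not> ed_guard \<kappa> (D k) a" if "a < num (D k)" for a
    using dis[of a] that by (auto simp: enabled_def energy_framework_def)
  have base: "\<not> enabled (sem_of A) (erase (D k)) a" for a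
  proof
    assume "enabled (sem_of A) (erase (D k)) a"
    then obtain g ops where g: "a < num (D k)" "(g, ops) \<in> A" "g (view (erase (D k)) a)"
      by (auto simp: enabled_def sem_of_def)
    have "energy_guard g (\<delta> (g, ops)) (D k) a"
      unfolding energy_guard_def
    proof (intro conjI ballI)
      show "\<delta> (g, ops) \<le> ebat (mem (D k) a)"
        using quiet_charged[OF k capacity(1) _ g(1)] quiet capacity(2)[OF g(2)] by simp
      fix b assume "b \<in> neighbors (D k) a \<union> {a}"
      then have "b < num (D k)" using g(1) by (auto simp: neighbors_def)
      then show "state (mem (D k) b) \<notin> {Idle, Pruning}"
        using quiet_not_idle[OF k, of b] quiet by fastforce
    qed (rule g(3))
    then have "enabled F (D k) a" using g(1,2) by (force simp: enabled_def energy_framework_def)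
    then show False using dis by blast
  qed
  obtain C s' where C: "C 0 = C0" "\<And>j. j < base_steps k \<Longrightarrow> step (sem_of A) (C j) (s' j) (C (Suc j))"
    "C (base_steps k) = erase (D k)" using simulation[of k] L by auto
  have "\<not> step (sem_of A) (erase (D k)) a c'" for a c'
    using base[of a] by (auto simp: step_def enabled_def)
  then have "execution (sem_of A) C s' (enat (base_steps k))"
    using C by (auto simp: execution_def)
  then show ?thesis using C base by (auto simp: terminates_at_def)
qed

section \<open>Rounds\<close>

context
  fixes k :: nat
  assumes k: "terminates_at F D L k"
begin

abbreviation rs :: "nat \<Rightarrow> nat" where "rs \<equiv> round_start F D s"

lemma L_eq: "L = enat k"
  using k by (simp add: terminates_at_def)

lemma round_next:
  assumes "rs i < k"
  shows "rs i < rs (Suc i)" "rs (Suc i) \<le> k"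
    and "enabled F (D (rs i)) a \<Longrightarrow>
      \<exists>j. rs i < j \<and> j \<le> rs (Suc i) \<and> (s (j - 1) = a \<or> \<not> enabled F (D j) a)"
proof -
  define P where "P t \<longleftrightarrow> rs i < t \<and> (\<forall>a. enabled F (D (rs i)) a \<longrightarrow>
    (\<exists>j. rs i < j \<and> j \<le> t \<and> (s (j - 1) = a \<or> \<not> enabled F (D j) a)))" for t
  have next_eq: "rs (Suc i) = (LEAST t. P t)" by (simp add: P_def)
  \<comment> \<open>At time \<open>k\<close> nobody is enabled, so termination itself ends any open
    round and the least such time exists.\<close>
  have "P k" using assms k by (auto simp: P_def terminates_at_def)
  then have "P (rs (Suc i))" "rs (Suc i) \<le> k"
    unfolding next_eq by (rule LeastI, rule Least_le)
  then show "rs i < rs (Suc i)" "rs (Suc i) \<le> k"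
    and "enabled F (D (rs i)) a \<Longrightarrow>
      \<exists>j. rs i < j \<and> j \<le> rs (Suc i) \<and> (s (j - 1) = a \<or> \<not> enabled F (D j) a)"
    by (auto simp: P_def)
qed

text \<open>Every round contains at least one step; this turns a bound on steps into one on
  rounds.\<close>

lemma rounds_length:
  assumes "\<And>j. j < m \<Longrightarrow> rs (i + j) < k"
  shows "rs i + m \<le> rs (i + m)"
  using assms
proof (induction m)
  case (Suc m)
  then have "rs i + m \<le> rs (i + m)" by simp
  also have "\<dots> < rs (i + Suc m)" using round_next(1)[of "i + m"] Suc.prems[of m] by simp
  finally show ?case by simp
qed simp

lemma pruning_enabled:
  assumes "a < num (D i)" "state (mem (D i) a) = Pruning"
  shows "enabled F (D i) a"
  using assms by (auto simp: enabled_def energy_framework_def ed_guard_def g_get_pruned_def)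

text \<open>\<open>Q j\<close> collects the roots that were pruning at the start of the round and
  have not acted before time \<open>j\<close>. Membership of the root in \<open>Q\<close> absorbs
  one unit of the level at the start, and at the end of the round \<open>Q\<close> is empty.\<close>

lemma round_level:
  assumes "rs i < k" "\<And>l. rs i \<le> l \<Longrightarrow> l < rs (Suc i) \<Longrightarrow> \<not> base_step l"
    and "level_of (D (rs i)) {} (Suc K)"
  shows "level_of (D (rs (Suc i))) {} K"
proof -
  let ?t = "rs i" and ?t' = "rs (Suc i)"
  define Q where "Q j = {q. q < num C0 \<and> state (mem (D ?t) q) = Pruning \<and>
    (\<forall>l. ?t \<le> l \<and> l < j \<longrightarrow> s l \<noteq> q)}" for j
  have num: "num (D j) = num C0" if "j \<le> k" for j using num_at that L_eq by simp
  have tk: "?t \<le> k" "?t' \<le> k" "?t < ?t'" using round_next[OF assms(1)] assms(1) by simp_all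
  interpret forest "num (D ?t)" "sources (D ?t)" "states (D ?t)" "par (D ?t)"
    using sound_at L_eq tk(1) by (intro soundD) simp
  have first: "level_of (D ?t) (Q ?t) K"
    unfolding level_def
  proof (intro conjI ballI allI impI)
    show "state (mem (D ?t) q) = Pruning" if "q \<in> Q ?t" for q using that by (simp add: Q_def)
    fix v assume v: "v < num (D ?t)" "unstable (states (D ?t)) (par (D ?t)) v"
    then obtain u where u: "u \<in> up (par (D ?t)) v" "state (mem (D ?t) u) = Pruning"
      by (auto simp: unstable_def)
    then have "u < num (D ?t)" using up_subset[of v] v(1) by auto
    then have "u \<in> Q ?t" using u num[OF tk(1)] by (simp add: Q_def)
    then have "1 \<le> asum (par (D ?t)) (\<lambda>u. of_bool (u \<in> Q ?t)) v"
      using member_le_sum[OF u(1), of "\<lambda>u. of_bool (u \<in> Q ?t) :: nat"] finite_up[of v] by (simp add: asum_def)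
    moreover have "dep (par (D ?t)) v + growers (states (D ?t)) (par (D ?t)) v \<le> Suc K"
      using assms(3) v by (simp add: level_def asum_def)
    ultimately show "dep (par (D ?t)) v + growers (states (D ?t)) (par (D ?t)) v
        \<le> K + asum (par (D ?t)) (\<lambda>u. of_bool (u \<in> Q ?t)) v" by linarith
  qed
  have level: "level_of (D j) (Q j) K" if "?t \<le> j" "j \<le> ?t'" for j
    using that
  proof (induction j rule: dec_induct)
    case base
    show ?case by (rule first)
  next
    case (step j)
    then have "settles \<kappa> (s j) (D j) (D (Suc j))" using assms(2) by (simp add: base_step_def)
    then have "level_of (D (Suc j)) (Q j - {s j}) K" using step by (simp add: settles_def)
    moreover have "Q j - {s j} = Q (Suc j)" using step.hyps by (auto simp: Q_def less_Suc_eq)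
    ultimately show ?case by simp
  qed
  have "Q ?t' = {}"
  proof (rule ccontr)
    assume "Q ?t' \<noteq> {}"
    then obtain q where q: "q \<in> Q ?t'" by blast
    have mono: "q \<in> Q j" if "j \<le> ?t'" for j using q that by (auto simp: Q_def)
    \<comment> \<open>An awaited root is still pruning and hence enabled, so the round cannot be
      done with it by its becoming disabled; it must act.\<close>
    have en: "enabled F (D j) q" if "?t \<le> j" "j \<le> ?t'" for j
      using level[OF that] mono[OF that(2)] num[of j] that tk
      by (intro pruning_enabled) (auto simp: level_def Q_def)
    then obtain j where "?t < j" "j \<le> ?t'" "s (j - 1) = q"
      using round_next(3)[OF assms(1) en[OF order_refl]] tk(3) en less_imp_le by meson
    then show False using q by (auto simp: Q_def dest!: spec[of _ "j - 1"])
  qed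
  then show ?thesis using level[of ?t'] tk(3) by simp
qed

text \<open>Depth and number of growing ancestors are each at most n, so the level starts at 2n and
  reaches 0 after 2n quiet rounds. The remaining rounds of \<open>W\<close> contain one step more
  than the potential can pay for.\<close>

lemma block:
  fixes i :: nat
  defines "W \<equiv> 2 * num C0 + (11 + \<kappa>) * (num C0)\<^sup>2 + 1"
  assumes lt: "\<And>j. j \<le> i + W \<Longrightarrow> rs j < k"
  shows "\<exists>l\<ge>rs i. l < rs (i + W) \<and> base_step l"
proof (rule ccontr)
  let ?n = "num C0" and ?B = "(11 + \<kappa>) * (num C0)\<^sup>2"
  assume "\<not> ?thesis"
  then have quiet: "\<not> base_step l" if "rs i \<le> l" "l < rs (i + W)" for l using that by blast
  have num: "num (D j) = ?n" and snd: "sound \<kappa> (D j)" if "j \<le> k" for j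
    using num_at sound_at that L_eq by simp_all
  have mono: "rs (i + l) \<le> rs (i + m)" if "l \<le> m" "m \<le> W" for l m
  proof -
    have "rs (i + l) + (m - l) \<le> rs (i + l + (m - l))"
      by (rule rounds_length) (use that lt in simp)
    then show ?thesis using that by simp
  qed
  have "level_of (D (rs (i + m))) {} (2 * ?n - m)" if "m \<le> 2 * ?n" for m
    using that
  proof (induction m)
    case 0
    have ik: "rs i \<le> k" using lt[of i] by simp
    interpret forest "num (D (rs i))" "sources (D (rs i))" "states (D (rs i))" "par (D (rs i))"
      using snd[OF ik] by (rule soundD)
    have "asum (par (D (rs i))) (\<lambda>_. 1) v + asum (par (D (rs i))) (\<lambda>u. of_bool (state (mem (D (rs i)) u) = Growing)) v
       \<le> ?n + ?n" if "v < num (D (rs i))" for v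
      using asum_le[OF that] num[OF ik] by (intro add_mono) auto
    then show ?case by (auto simp: level_def mult_2 intro: trans_le_add1)
  next
    case (Suc m)
    have "level_of (D (rs (Suc (i + m)))) {} (2 * ?n - Suc m)"
    proof (rule round_level)
      show "rs (i + m) < k" using lt Suc.prems by (simp add: W_def)
      show "\<not> base_step l" if "rs (i + m) \<le> l" "l < rs (Suc (i + m))" for l
      proof (rule quiet)
        show "rs i \<le> l" using that(1) mono[of 0 m] Suc.prems by (simp add: W_def)
        show "l < rs (i + W)" using that(2) mono[of "Suc m" W] Suc.prems by (simp add: W_def)
      qed
      show "level_of (D (rs (i + m))) {} (Suc (2 * ?n - Suc m))"
        using Suc by (simp add: Suc_diff_Suc)
    qed
    then show ?case by simp
  qed
  from this[of "2 * ?n"] have "level_of (D (rs (i + 2 * ?n))) {} 0" by simp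
  define t where "t = rs (i + 2 * ?n)"
  have tk: "t < k" using lt by (simp add: t_def W_def)
  interpret forest "num (D t)" "sources (D t)" "states (D t)" "par (D t)"
    using snd[of t] tk by (intro soundD) simp
  have "\<not> unstable (states (D t)) (par (D t)) v" if "v < num (D t)" for v
  proof
    assume "unstable (states (D t)) (par (D t)) v"
    then have "dep (par (D t)) v \<le> 0"
      using \<open>level_of (D (rs (i + 2 * ?n))) {} 0\<close> that by (auto simp: t_def level_def asum_def)
    then show False using dep_pos[of v] by simp
  qed
  then have u: "unrest_of (D t) = 0" by (simp add: unrest_def)
  have end_k: "rs (i + W) < k" using lt by simp
  have "unrest_of (D (t + j)) = 0 \<and> potential \<kappa> (D (t + j)) + j \<le> potential \<kappa> (D t)"
    if "t + j \<le> rs (i + W)" for j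
    using that
  proof (induction j)
    case 0
    show ?case using u by simp
  next
    case (Suc j)
    have "rs i \<le> t" using mono[of 0 "2 * ?n"] by (simp add: t_def W_def)
    then have "settles \<kappa> (s (t + j)) (D (t + j)) (D (Suc (t + j)))"
      using quiet[of "t + j"] Suc.prems by (simp add: base_step_def)
    \<comment> \<open>\<open>unrest\<close> is already 0, so of the two alternatives in
      \<open>settles\<close> only the drop of the potential is left.\<close>
    then have "unrest_of (D (Suc (t + j))) = unrest_of (D (t + j)) \<and>
        potential \<kappa> (D (Suc (t + j))) < potential \<kappa> (D (t + j))"
      using Suc by (simp add: settles_def)
    then show ?case using Suc by simp
  qed
  moreover have "t + (?B + 1) \<le> rs (i + W)"
  proof -
    have "rs (i + 2 * ?n) + (?B + 1) \<le> rs (i + 2 * ?n + (?B + 1))"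
      by (rule rounds_length) (use lt in \<open>simp add: W_def\<close>)
    then show ?thesis by (simp add: t_def W_def algebra_simps)
  qed
  ultimately have "?B + 1 \<le> potential \<kappa> (D t)" by fastforce
  then show False using potential_le[OF snd[of t]] num[of t] tk by simp
qed

text \<open>Each block of \<open>W\<close> rounds contains a base step, so one block more than there
  are base steps cannot fit before time \<open>k\<close>.\<close>

lemma round_bound:
  "\<exists>r\<le>(base_steps k + 1) * (2 * num C0 + (11 + \<kappa>) * (num C0)\<^sup>2 + 1). rs r = k"
proof -
  define W where "W = 2 * num C0 + (11 + \<kappa>) * (num C0)\<^sup>2 + 1"
  have "\<exists>r\<le>(base_steps k + 1) * W. k \<le> rs r"
  proof (rule ccontr)
    assume "\<not> ?thesis"
    then have lt: "rs r < k" if "r \<le> (base_steps k + 1) * W" for r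
      using that by (meson linorder_not_less)
    have "b \<le> base_steps (rs (b * W))" if "b \<le> base_steps k + 1" for b
      using that
    proof (induction b)
      case (Suc b)
      have le: "Suc b * W \<le> (base_steps k + 1) * W" using Suc.prems by (rule mult_le_mono1)
      have "\<exists>l\<ge>rs (b * W). l < rs (b * W + W) \<and> base_step l"
      proof (rule block[of "b * W", folded W_def])
        show "rs j < k" if "j \<le> b * W + W" for j
          using that by (intro lt order_trans[OF _ le]) simp
      qed
      then obtain l where "rs (b * W) \<le> l" "l < rs (b * W + W)" "base_step l" by blast
      then have "base_steps (rs (b * W)) < base_steps (rs (Suc b * W))"
        by (intro base_steps_less[of _ l]) (simp_all add: add.commute)
      then show ?case using Suc by simp
    qed simp
    from this[of "base_steps k + 1"]
    have "base_steps k < base_steps (rs ((base_steps k + 1) * W))" by simp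
    moreover have "\<dots> \<le> base_steps k"
      using lt by (intro base_steps_mono) (simp add: less_imp_le)
    ultimately show False by simp
  qed
  then obtain r0 where r0: "r0 \<le> (base_steps k + 1) * W" "k \<le> rs r0" by blast
  \<comment> \<open>Rounds are meaningful only up to time \<open>k\<close>. The first one to reach
    \<open>k\<close> does not overshoot, because the round before it started earlier than
    \<open>k\<close>.\<close>
  define r where "r = (LEAST r. k \<le> rs r)"
  have r: "k \<le> rs r" "r \<le> r0" unfolding r_def using r0 by (auto intro: LeastI Least_le)
  have "rs r \<le> k"
  proof (cases r)
    case (Suc r')
    then have "rs r' < k" using not_less_Least[of r' "\<lambda>r. k \<le> rs r"] by (simp add: r_def)
    then show ?thesis using round_next(2) Suc by simp
  qed simp
  then show ?thesis using r r0(1) unfolding W_def by (intro exI[of _ r]) auto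
qed

end

end

theorem theorem4:
  fixes A :: "('m :: finite) action set"
    and Init :: "'m config set"
    and \<kappa> :: nat
    and \<delta> :: "'m action \<Rightarrow> nat"
  assumes "finite A"
    and "\<forall>c\<in>Init. legal c"
    and "energy_compatible Init A"
    and "\<kappa> > 0"
    and "\<forall>\<alpha>\<in>A. \<delta> \<alpha> \<in> {1..\<kappa>}"
  shows "(\<forall>C0 D0 D s L k.
           C0 \<in> Init \<and> connected_config C0 \<and> energy_extension C0 D0 \<and>
           D 0 = D0 \<and> execution (energy_framework \<kappa> \<delta> A) D s L \<and>
           terminates_at (energy_framework \<kappa> \<delta> A) D L k \<longrightarrow>
           (\<exists>C s' L' k'.
              C 0 = C0 \<and> execution (sem_of A) C s' L' \<and>
              terminates_at (sem_of A) C L' k' \<and> C k' = erase (D k))) \<and>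
         (\<forall>T :: nat \<Rightarrow> nat.
           (\<forall>C s L.
              C 0 \<in> Init \<and> execution (sem_of A) C s L \<longrightarrow>
              (\<exists>k\<le>T (num (C 0)). terminates_at (sem_of A) C L k)) \<longrightarrow>
           (\<exists>R :: nat \<Rightarrow> nat.
              (\<lambda>n. real (R n)) \<in> O(\<lambda>n. real (n\<^sup>2 * max 1 (T n))) \<and>
              (\<forall>C0 D0 D s L.
                 C0 \<in> Init \<and> connected_config C0 \<and> energy_extension C0 D0 \<and>
                 D 0 = D0 \<and> execution (energy_framework \<kappa> \<delta> A) D s L \<longrightarrow>
                 (\<exists>r\<le>R (num C0). terminates_in_rounds (energy_framework \<kappa> \<delta> A) D s L r))))"
proof -
  have run: "energy_run A Init \<kappa> \<delta> C0 D s L"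
    if "C0 \<in> Init" "connected_config C0" "energy_extension C0 (D 0)"
      "execution (energy_framework \<kappa> \<delta> A) D s L" for C0 D s L
    by unfold_locales (use that assms in auto)
  show ?thesis
  proof (rule conjI; intro allI impI; (elim conjE)?)
    fix C0 D0 D s L k
    assume *: "C0 \<in> Init" "connected_config C0" "energy_extension C0 D0" "D 0 = D0"
      "execution (energy_framework \<kappa> \<delta> A) D s L" "terminates_at (energy_framework \<kappa> \<delta> A) D L k"
    then interpret energy_run A Init \<kappa> \<delta> C0 D s L by (intro run) simp_all
    show "\<exists>C s' L' k'. C 0 = C0 \<and> execution (sem_of A) C s' L' \<and>
              terminates_at (sem_of A) C L' k' \<and> C k' = erase (D k)"
      using base_execution[OF *(6)] by blast
  next
    fix T :: "nat \<Rightarrow> nat"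
    assume T: "\<forall>C s L. C 0 \<in> Init \<and> execution (sem_of A) C s L \<longrightarrow>
              (\<exists>k\<le>T (num (C 0)). terminates_at (sem_of A) C L k)"
    \<comment> \<open>For \<open>n \<ge> 1\<close> the terms 2n and 1 are absorbed into n^2, which
      gives 14 = 11 + 2 + 1; the factor 2 bounds \<open>T n + 1\<close> by
      \<open>max 1 (T n)\<close>. The maximum covers \<open>T n = 0\<close>, where energy still has
      to be distributed.\<close>
    define R where "R n = (T n + 1) * (2 * n + (11 + \<kappa>) * n\<^sup>2 + 1)" for n
    have "R n \<le> (2 * (14 + \<kappa>)) * (n\<^sup>2 * max 1 (T n))" if "n \<ge> 1" for n
    proof -
      have "n \<le> n\<^sup>2" "1 \<le> n\<^sup>2" using that by (simp_all add: power2_eq_square)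
      then have "2 * n + (11 + \<kappa>) * n\<^sup>2 + 1 \<le> (14 + \<kappa>) * n\<^sup>2" by (simp add: algebra_simps)
      moreover have "T n + 1 \<le> 2 * max 1 (T n)" by simp
      ultimately have "R n \<le> (2 * max 1 (T n)) * ((14 + \<kappa>) * n\<^sup>2)"
        unfolding R_def by (rule mult_le_mono[rotated])
      then show ?thesis by (simp only: mult_ac)
    qed
    then have "real (R n) \<le> real (2 * (14 + \<kappa>)) * real (n\<^sup>2 * max 1 (T n))" if "n \<ge> 1" for n
      using that unfolding of_nat_mult[symmetric] of_nat_le_iff by blast
    then have "(\<lambda>n. real (R n)) \<in> O(\<lambda>n. real (n\<^sup>2 * max 1 (T n)))"
      by (intro bigoI[of _ "real (2 * (14 + \<kappa>))"] eventually_at_top_linorderI[of 1])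
        (simp del: of_nat_mult)
    moreover have "\<exists>r\<le>R (num C0). terminates_in_rounds (energy_framework \<kappa> \<delta> A) D s L r"
      if *: "C0 \<in> Init" "connected_config C0" "energy_extension C0 D0" "D 0 = D0"
        "execution (energy_framework \<kappa> \<delta> A) D s L" for C0 D0 D s L
    proof -
      interpret energy_run A Init \<kappa> \<delta> C0 D s L using * by (intro run) simp_all
      obtain k where k: "terminates_at (energy_framework \<kappa> \<delta> A) D L k" using terminates by blast
      obtain C s' where C: "C 0 = C0" "execution (sem_of A) C s' (enat (base_steps k))"
        using base_execution[OF k] by blast
      then have "\<exists>k'\<le>T (num C0). terminates_at (sem_of A) C (enat (base_steps k)) k'"
        using T *(1) by blast
      \<comment> \<open>The simulated execution has length exactly \<open>base_steps k\<close>, and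
        termination can only occur at its end.\<close>
      then have "base_steps k \<le> T (num C0)" by (auto simp: terminates_at_def)
      then have "(base_steps k + 1) * (2 * num C0 + (11 + \<kappa>) * (num C0)\<^sup>2 + 1) \<le> R (num C0)"
        unfolding R_def by (intro mult_le_mono1) simp
      moreover obtain r where "r \<le> (base_steps k + 1) * (2 * num C0 + (11 + \<kappa>) * (num C0)\<^sup>2 + 1)"
        "round_start (energy_framework \<kappa> \<delta> A) D s r = k"
        using round_bound[OF k] by blast
      ultimately show ?thesis using k unfolding terminates_in_rounds_def by (meson order_trans)
    qed
    ultimately show "\<exists>R :: nat \<Rightarrow> nat.
              (\<lambda>n. real (R n)) \<in> O(\<lambda>n. real (n\<^sup>2 * max 1 (T n))) \<and>
              (\<forall>C0 D0 D s L.
                 C0 \<in> Init \<and> connected_config C0 \<and> energy_extension C0 D0 \<and>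
                 D 0 = D0 \<and> execution (energy_framework \<kappa> \<delta> A) D s L \<longrightarrow>
                 (\<exists>r\<le>R (num C0). terminates_in_rounds (energy_framework \<kappa> \<delta> A) D s L r))"
      by blast
  qed
qed

end
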